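(* Let $\pi_1,\pi_2\in(0,\tfrac12)$, $f_1,f_2\in(0,1)$ and $\alpha>1$. For $N\in\{1,2\}$ let $\mathbb{E}U_j^{N}$ be the equilibrium ex ante expected payoff of player $j\in\{1,2,DP\}$ (where $j=1,2$ stands for $GI_1,GI_2$) in the $N$-game (game and equilibrium as defined in the context). Then $$\mathbb{E}U_j^{N=1}\ge\mathbb{E}U_j^{N=2}\quad\text{for every } j\in\{1,2,DP\},\ \text{with at least one strict inequality},$$ if and only if $$\frac{\alpha\pi_1f_1+(2\alpha-1)\pi_2f_2}{\pi_1\pi_2}\le1 .$$
   Context: **The $N$-game.** Players: a decision maker DP and two interest groups $GI_1,GI_2$. Parameters: $\pi_i\in(0,\frac12)$, lobbying costs $f_i\in(0,1)$, $\alpha>1$. $N\in\{1,2\}$ is the maximal number of issues DP can reform. "$-i$" denotes the index other than $i$. All parameters are common knowledge. Timing. (Stage 1) Nature draws independent states $\theta_1,\theta_2\in\{0,1\}$ with $\Pr(\theta_i=1)=\pi_i$; $GI_i$ privately observes $\theta_i$. (Stage 2) The groups simultaneously choose whether to lobby: $\lambda_i\in\{0,1\}$, $\lambda_i=1$ meaning $GI_i$ lobbies. (Stage 3) DP observes $\lambda=(\lambda_1,\lambda_2)$ and grants access ($\psi_i=1$) to at most one group, which must have lobbied: if exactly one group lobbies it gets access; if both lobby, exactly one gets access; if none lobbies, $\psi=(0,0)$. If $\psi_i=1$ then $\theta_i$ is revealed to DP. (Stage 4) DP chooses $p=(p_1,p_2)\in\{0,1\}^2$ with $p_1+p_2\le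 N$ ($p_i=1$ means reforming issue $i$). Payoffs. DP gets $\alpha u_1(p_1,\theta_1)+u_2(p_2,\theta_2)$ where $u_i(p_i,\theta_i)=1$ if $p_i=\theta_i$ and $0$ otherwise. $GI_i$ gets $p_i-f_i\lambda_i$. Strategies (possibly mixed). $\xi_i(\theta_i)\in[0,1]$ is the probability that $GI_i$ lobbies given $\theta_i$. $\gamma_i$ is the probability that DP grants access to $GI_i$ when both lobby ($\gamma_1+\gamma_2=1$). $\rho_i$ is the probability that $p_i=1$ given $\lambda$, $\psi$ and the revealed state, if any; for $N=2$ the choice on issue $i$ depends only on DP's information about issue $i$. Beliefs. At Stage 3, $B_i^A(\lambda_i)$ is DP's belief that $\theta_i=1$ after observing $\lambda_i$. At Stage 4, DP's belief that $\theta_i=1$ is equal to $\theta_i$ if $\psi_i=1$ and to $B_i^A(\lambda_i)$ if $\psi_i=0$. Equilibrium (perfect Bayesian). A set of strategies (lobbying, access, policy) and a system of beliefs such that the strategies are sequentially rational given the beliefs and the beliefs are given by Bayes' rule whenever possible.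
   Formalization: Equilibrium payoffs are not always unique: the equivalence is proved for "all pairs of equilibria improve" at all parameters, and for each single pair of equilibria only when f_2 ≠ 1−π_1, since at f_2 = 1−π_1 DP's payoff is not unique and the pairwise claim fails. *)

theory Defs
  imports Complex_Main
begin

datatype issue = Issue1 | Issue2

fun other :: "issue \<Rightarrow> issue" where
  "other Issue1 = Issue2"
| "other Issue2 = Issue1"

lemma UNIV_issue: "(UNIV :: issue set) = {Issue1, Issue2}"
  using issue.exhaust by auto

instance issue :: finite
  by standard (simp add: UNIV_issue)

datatype player = GI issue | DP

text \<open>
  States and lobbying decisions are profiles \<open>issue \<Rightarrow> bool\<close> (\<open>True\<close> is 1).
  An access decision is an \<open>issue option\<close>: \<open>Some i\<close> means that access is granted to the group
  of issue \<open>i\<close> only, \<open>None\<close> that nobody gets access.  What access reveals to the decision maker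
  is a signal \<open>(issue \<times> bool) option\<close>: \<open>Some (i, t)\<close> means that the group of issue \<open>i\<close>
  got access and that its state was revealed to be \<open>t\<close>.  A Stage 4 information set is thus
  a lobbying profile together with a signal.
\<close>

type_synonym profile = "issue \<Rightarrow> bool"
type_synonym signal = "(issue \<times> bool) option"

text \<open>
  Strategies and beliefs.  \<open>lobby \<sigma> i t\<close> is the probability that the group of issue \<open>i\<close> lobbies
  in state \<open>t\<close>; \<open>access \<sigma> i\<close> is the probability that it gets access when both lobby;
  \<open>policy \<sigma> L s i\<close> is the probability that issue \<open>i\<close> is reformed at the information set
  \<open>(L, s)\<close>; \<open>belief \<sigma> i l\<close> is the Stage 3 belief that the state of issue \<open>i\<close> is 1 when the
  lobbying decision of its group is \<open>l\<close>.
\<close>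

record assessment =
  lobby :: "issue \<Rightarrow> bool \<Rightarrow> real"
  access :: "issue \<Rightarrow> real"
  policy :: "profile \<Rightarrow> signal \<Rightarrow> issue \<Rightarrow> real"
  belief :: "issue \<Rightarrow> bool \<Rightarrow> real"

definition bern :: "real \<Rightarrow> bool \<Rightarrow> real" where
  "bern q b = (if b then q else 1 - q)"

definition access_prob :: "assessment \<Rightarrow> profile \<Rightarrow> issue option \<Rightarrow> real" where
  "access_prob \<sigma> L \<psi> =
    (case \<psi> of
       None \<Rightarrow> if L Issue1 \<or> L Issue2 then 0 else 1
     | Some i \<Rightarrow> if L i then (if L (other i) then access \<sigma> i else 1) else 0)"

definition reveal :: "profile \<Rightarrow> issue option \<Rightarrow> signal" where
  "reveal \<theta> \<psi> = map_option (\<lambda>i. (i, \<theta> i)) \<psi>"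

definition info_set :: "profile \<Rightarrow> signal \<Rightarrow> bool" where
  "info_set L s = (case s of None \<Rightarrow> \<not> L Issue1 \<and> \<not> L Issue2 | Some (i, t) \<Rightarrow> L i)"

definition u :: "bool \<Rightarrow> bool \<Rightarrow> real" where
  "u p t = (if p = t then 1 else 0)"

text \<open>
  A mixed policy is given by its marginals \<open>r i\<close>, the probability of reforming issue \<open>i\<close>.
  Payoffs are additive across issues, so expected payoffs depend on the marginals only.
\<close>

definition expected_u :: "real \<Rightarrow> bool \<Rightarrow> real" where
  "expected_u r t = (\<Sum>p\<in>UNIV. bern r p * u p t)"

fun payoff ::
  "(issue \<Rightarrow> real) \<Rightarrow> real \<Rightarrow> player \<Rightarrow> profile \<Rightarrow> profile \<Rightarrow> (issue \<Rightarrow> real) \<Rightarrow> real" where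
  "payoff f \<alpha> (GI i) \<theta> L r = r i - f i * of_bool (L i)"
| "payoff f \<alpha> DP \<theta> L r =
     \<alpha> * expected_u (r Issue1) (\<theta> Issue1) + expected_u (r Issue2) (\<theta> Issue2)"

definition continuation_payoff ::
  "(issue \<Rightarrow> real) \<Rightarrow> real \<Rightarrow> assessment \<Rightarrow> player \<Rightarrow> profile \<Rightarrow> profile \<Rightarrow> real" where
  "continuation_payoff f \<alpha> \<sigma> j \<theta> L =
    (\<Sum>\<psi>\<in>UNIV. access_prob \<sigma> L \<psi> * payoff f \<alpha> j \<theta> L (policy \<sigma> L (reveal \<theta> \<psi>)))"

definition ex_ante_payoff ::
  "(issue \<Rightarrow> real) \<Rightarrow> (issue \<Rightarrow> real) \<Rightarrow> real \<Rightarrow> assessment \<Rightarrow> player \<Rightarrow> real" where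
  "ex_ante_payoff \<pi> f \<alpha> \<sigma> j =
    (\<Sum>\<theta>\<in>UNIV. \<Sum>L\<in>UNIV.
       (\<Prod>i\<in>UNIV. bern (\<pi> i) (\<theta> i) * bern (lobby \<sigma> i (\<theta> i)) (L i))
       * continuation_payoff f \<alpha> \<sigma> j \<theta> L)"

text \<open>
  Lotteries over \<open>(p\<^sub>1, p\<^sub>2) \<in> {0,1}\<^sup>2\<close> with \<open>p\<^sub>1 + p\<^sub>2 \<le> N\<close> have exactly these marginals
  (for \<open>N = 1\<close> and \<open>N = 2\<close>).
\<close>

definition feasible_policy :: "nat \<Rightarrow> (issue \<Rightarrow> real) \<Rightarrow> bool" where
  "feasible_policy N r \<longleftrightarrow> (\<forall>i. r i \<in> {0..1}) \<and> r Issue1 + r Issue2 \<le> real N"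

definition own_signal :: "signal \<Rightarrow> issue \<Rightarrow> bool option" where
  "own_signal s i = (case s of None \<Rightarrow> None | Some (k, t) \<Rightarrow> if k = i then Some t else None)"

definition issuewise_policy :: "assessment \<Rightarrow> bool" where
  "issuewise_policy \<sigma> \<longleftrightarrow>
    (\<forall>L s L' s' i. info_set L s \<and> info_set L' s' \<and> L i = L' i \<and> own_signal s i = own_signal s' i
       \<longrightarrow> policy \<sigma> L s i = policy \<sigma> L' s' i)"

definition valid_strategies :: "nat \<Rightarrow> assessment \<Rightarrow> bool" where
  "valid_strategies N \<sigma> \<longleftrightarrow>
    (\<forall>i t. lobby \<sigma> i t \<in> {0..1}) \<and>
    (\<forall>i. access \<sigma> i \<in> {0..1}) \<and> access \<sigma> Issue1 + access \<sigma> Issue2 = 1 \<and>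
    (\<forall>L s. info_set L s \<longrightarrow> feasible_policy N (policy \<sigma> L s)) \<and>
    (N = 2 \<longrightarrow> issuewise_policy \<sigma>)"

definition lobby_prob :: "(issue \<Rightarrow> real) \<Rightarrow> assessment \<Rightarrow> issue \<Rightarrow> bool \<Rightarrow> real" where
  "lobby_prob \<pi> \<sigma> i l = (\<Sum>t\<in>UNIV. bern (\<pi> i) t * bern (lobby \<sigma> i t) l)"

definition bayes_consistent :: "(issue \<Rightarrow> real) \<Rightarrow> assessment \<Rightarrow> bool" where
  "bayes_consistent \<pi> \<sigma> \<longleftrightarrow>
    (\<forall>i l. belief \<sigma> i l \<in> {0..1} \<and>
       (lobby_prob \<pi> \<sigma> i l > 0 \<longrightarrow>
          belief \<sigma> i l = \<pi> i * bern (lobby \<sigma> i True) l / lobby_prob \<pi> \<sigma> i l))"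

definition final_belief :: "assessment \<Rightarrow> profile \<Rightarrow> signal \<Rightarrow> issue \<Rightarrow> real" where
  "final_belief \<sigma> L s i =
    (case own_signal s i of Some t \<Rightarrow> of_bool t | None \<Rightarrow> belief \<sigma> i (L i))"

definition dp_value :: "real \<Rightarrow> (issue \<Rightarrow> real) \<Rightarrow> (issue \<Rightarrow> real) \<Rightarrow> real" where
  "dp_value \<alpha> b r =
    \<alpha> * (\<Sum>t\<in>UNIV. bern (b Issue1) t * expected_u (r Issue1) t)
    + (\<Sum>t\<in>UNIV. bern (b Issue2) t * expected_u (r Issue2) t)"

definition policy_rational :: "nat \<Rightarrow> real \<Rightarrow> assessment \<Rightarrow> bool" where
  "policy_rational N \<alpha> \<sigma> \<longleftrightarrow>
    (\<forall>L s r. info_set L s \<and> feasible_policy N r \<longrightarrow>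
       dp_value \<alpha> (final_belief \<sigma> L s) r \<le> dp_value \<alpha> (final_belief \<sigma> L s) (policy \<sigma> L s))"

definition access_value :: "real \<Rightarrow> assessment \<Rightarrow> issue \<Rightarrow> real" where
  "access_value \<alpha> \<sigma> i =
    (\<Sum>t\<in>UNIV. bern (belief \<sigma> i True) t *
       dp_value \<alpha> (final_belief \<sigma> (\<lambda>_. True) (Some (i, t))) (policy \<sigma> (\<lambda>_. True) (Some (i, t))))"

definition access_rational :: "real \<Rightarrow> assessment \<Rightarrow> bool" where
  "access_rational \<alpha> \<sigma> \<longleftrightarrow>
    (\<forall>i. access_value \<alpha> \<sigma> i \<le> (\<Sum>k\<in>UNIV. access \<sigma> k * access_value \<alpha> \<sigma> k))"

definition lobby_value ::
  "(issue \<Rightarrow> real) \<Rightarrow> (issue \<Rightarrow> real) \<Rightarrow> real \<Rightarrow> assessment \<Rightarrow> issue \<Rightarrow> bool \<Rightarrow> bool \<Rightarrow> real" where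
  "lobby_value \<pi> f \<alpha> \<sigma> i t l =
    (\<Sum>t'\<in>UNIV. \<Sum>l'\<in>UNIV.
       bern (\<pi> (other i)) t' * bern (lobby \<sigma> (other i) t') l' *
       continuation_payoff f \<alpha> \<sigma> (GI i)
         (\<lambda>k. if k = i then t else t') (\<lambda>k. if k = i then l else l'))"

definition lobby_rational ::
  "(issue \<Rightarrow> real) \<Rightarrow> (issue \<Rightarrow> real) \<Rightarrow> real \<Rightarrow> assessment \<Rightarrow> bool" where
  "lobby_rational \<pi> f \<alpha> \<sigma> \<longleftrightarrow>
    (\<forall>i t l. lobby_value \<pi> f \<alpha> \<sigma> i t l
       \<le> (\<Sum>l'\<in>UNIV. bern (lobby \<sigma> i t) l' * lobby_value \<pi> f \<alpha> \<sigma> i t l'))"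

text \<open>
  Perfect Bayesian equilibrium: rationality is required at every information set, and beliefs
  after lobbying decisions of probability 0 are arbitrary in \<open>[0, 1]\<close>.
\<close>

definition equilibrium ::
  "(issue \<Rightarrow> real) \<Rightarrow> (issue \<Rightarrow> real) \<Rightarrow> real \<Rightarrow> nat \<Rightarrow> assessment \<Rightarrow> bool" where
  "equilibrium \<pi> f \<alpha> N \<sigma> \<longleftrightarrow>
    valid_strategies N \<sigma> \<and> bayes_consistent \<pi> \<sigma> \<and>
    lobby_rational \<pi> f \<alpha> \<sigma> \<and> access_rational \<alpha> \<sigma> \<and> policy_rational N \<alpha> \<sigma>"

text \<open>
  Equilibrium payoffs need not be unique, so payoffs are compared equilibrium by equilibrium.
  If \<open>f Issue2 = 1 - \<pi> Issue1\<close>, the comparison can depend on the equilibria chosen: for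
  \<open>N = 1\<close> group 2 is then indifferent in state 1 and may lobby with any probability, while for
  \<open>N = 2\<close> it may refrain from lobbying, deterred by the off-path belief 0.
\<close>

definition pareto_improves ::
  "(issue \<Rightarrow> real) \<Rightarrow> (issue \<Rightarrow> real) \<Rightarrow> real \<Rightarrow> assessment \<Rightarrow> assessment \<Rightarrow> bool" where
  "pareto_improves \<pi> f \<alpha> \<sigma> \<tau> \<longleftrightarrow>
    (\<forall>j. ex_ante_payoff \<pi> f \<alpha> \<sigma> j \<ge> ex_ante_payoff \<pi> f \<alpha> \<tau> j) \<and>
    (\<exists>j. ex_ante_payoff \<pi> f \<alpha> \<sigma> j > ex_ante_payoff \<pi> f \<alpha> \<tau> j)"

end

theory Submission
  imports Defs
begin

text \<open>
  With one reform, a low type never lobbies: he could only gain when access goes to the other group,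
  but a belief about issue 1 that is at least 1/2 and not certain makes access to group 1 strictly
  better.  So lobbying is truthful, group 2 is served only when group 1 is silent, and the decision
  maker errs (for cheap lobbying) only when both states are 1, losing \<open>\<pi>\<^sub>1\<pi>\<^sub>2\<close>.

  With two reforms, a low type may lobby and hope that the other group gets access.  High types of a
  group that lobbies at all lobby for sure.  If \<open>\<pi>\<^sub>1f\<^sub>1 + \<pi>\<^sub>2f\<^sub>2 < \<pi>\<^sub>1\<pi>\<^sub>2\<close>, lobbying cannot be
  truthful, both groups lobby in the low state, access must be random, and hence
  \<open>\<alpha>(1 - B\<^sub>1) = 1 - B\<^sub>2\<close>.  Low-type indifference then forces \<open>B\<^sub>2 = 1/2\<close>, and all payoffs are determined.
  Group 1's payoff is the same in both games, the decision maker strictly prefers one reform, and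
  group 2 weakly prefers it exactly under the stated inequality.  In all other equilibria with two
  reforms some group is strictly better off than with one reform, or all payoffs agree, apart from
  the knife-edge case \<open>f\<^sub>2 = 1 - \<pi>\<^sub>1\<close>.
\<close>

section \<open>Finite sums and expected payoffs\<close>

lemma other_simps [simp]: "other (other i) = i" "other i \<noteq> i" "i \<noteq> other i"
  by (cases i; simp)+

lemma UNIV_issue_other: "UNIV = {i, other i}"
  by (cases i) (auto simp: UNIV_issue)

lemma issue_cases: "k = i \<or> k = other i"
  using UNIV_issue_other[of i] by auto

lemma all_issue: "(\<forall>k. P k) \<longleftrightarrow> P i \<and> P (other i)"
  by (metis issue_cases)

lemma sum_issue: "sum g UNIV = g i + g (other i)" for g :: "issue \<Rightarrow> real"
  unfolding UNIV_issue_other[of i] by simp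

lemma prod_issue: "prod g UNIV = g i * g (other i)" for g :: "issue \<Rightarrow> real"
  unfolding UNIV_issue_other[of i] by simp

lemma sum_issue_option: "sum g UNIV = g None + g (Some i) + g (Some (other i))"
  for g :: "issue option \<Rightarrow> real"
  unfolding UNIV_option_conv UNIV_issue_other[of i] by (simp add: ac_simps)

lemma sum_bool: "sum g UNIV = g True + g False" for g :: "bool \<Rightarrow> real"
  by (simp add: UNIV_bool)

text \<open>Writing profiles relative to a distinguished issue lets one argument treat a group and
  its rival for either labelling.\<close>

definition pair_fun :: "issue \<Rightarrow> 'a \<Rightarrow> 'a \<Rightarrow> issue \<Rightarrow> 'a" where
  "pair_fun i a b = (\<lambda>k. if k = i then a else b)"

lemma pair_fun_simps [simp]: "pair_fun i a b i = a" "pair_fun i a b (other i) = b" "pair_fun i a a = (\<lambda>_. a)"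
  "pair_fun Issue1 a b Issue2 = b" "pair_fun Issue2 a b Issue1 = b"
  by (auto simp: pair_fun_def)

lemma pair_fun_eta: "pair_fun i (L i) (L (other i)) = L"
  using issue_cases[of _ i] by (fastforce simp: pair_fun_def)

lemma sum_profile:
  "sum F UNIV = (\<Sum>a\<in>UNIV. \<Sum>b\<in>UNIV. F (pair_fun i a b))" for F :: "profile \<Rightarrow> real"
proof -
  have "sum F UNIV = (\<Sum>(a, b)\<in>UNIV \<times> UNIV. F (pair_fun i a b))"
    by (rule sum.reindex_bij_witness[of _ "\<lambda>(a, b). pair_fun i a b" "\<lambda>L. (L i, L (other i))"])
      (auto simp: pair_fun_eta)
  then show ?thesis by (simp add: sum.cartesian_product)
qed

lemma bern_simps [simp]: "bern q True = q" "bern q False = 1 - q"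
  by (simp_all add: bern_def)

lemma expected_u_eq: "expected_u r t = (if t then r else 1 - r)"
  by (cases t) (simp_all add: expected_u_def u_def sum_bool)

definition weight :: "real \<Rightarrow> issue \<Rightarrow> real" where
  "weight \<alpha> i = (if i = Issue1 then \<alpha> else 1)"

text \<open>The probability of a right decision under belief \<open>b\<close> when reform has
  probability \<open>r\<close>: affine in \<open>r\<close> with slope \<open>2 * b - 1\<close>, so
  1/2 is the threshold belief.\<close>

definition correct :: "real \<Rightarrow> real \<Rightarrow> real" where
  "correct b r = 1 - b + (2 * b - 1) * r"

lemma dp_value_eq:
  "dp_value \<alpha> b r = weight \<alpha> i * correct (b i) (r i)
     + weight \<alpha> (other i) * correct (b (other i)) (r (other i))"
  by (cases i) (simp_all add: dp_value_def weight_def correct_def expected_u_eq sum_bool algebra_simps)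

lemma payoff_DP_eq:
  "payoff f \<alpha> DP \<theta> L r = weight \<alpha> i * expected_u (r i) (\<theta> i)
     + weight \<alpha> (other i) * expected_u (r (other i)) (\<theta> (other i))"
  by (cases i) (simp_all add: weight_def)

lemma continuation_payoff_eq:
  "continuation_payoff f \<alpha> \<sigma> j \<theta> L =
    (let P = (\<lambda>s. payoff f \<alpha> j \<theta> L (policy \<sigma> L s)) in
     if L i then
       if L (other i)
       then access \<sigma> i * P (Some (i, \<theta> i)) + access \<sigma> (other i) * P (Some (other i, \<theta> (other i)))
       else P (Some (i, \<theta> i))
     else if L (other i) then P (Some (other i, \<theta> (other i))) else P None)"
proof -
  have "(L Issue1 \<or> L Issue2) \<longleftrightarrow> L i \<or> L (other i)" by (cases i) auto
  then show ?thesis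
    unfolding continuation_payoff_def sum_issue_option[of _ i] access_prob_def reveal_def
    by (simp add: Let_def)
qed

lemma info_set_simps [simp]:
  "info_set L (Some (i, t)) = L i"
  "info_set L None = (\<not> L Issue1 \<and> \<not> L Issue2)"
  by (simp_all add: info_set_def)

lemma own_signal_simps [simp]:
  "own_signal None i = None" "own_signal (Some (i, t)) i = Some t"
  "own_signal (Some (i, t)) (other i) = None" "own_signal (Some (other i, t)) i = None"
  by (simp_all add: own_signal_def)

lemma lobby_prob_eq:
  "lobby_prob \<pi> \<sigma> i True = \<pi> i * lobby \<sigma> i True + (1 - \<pi> i) * lobby \<sigma> i False"
  "lobby_prob \<pi> \<sigma> i False = 1 - lobby_prob \<pi> \<sigma> i True"
  by (simp_all add: lobby_prob_def sum_bool algebra_simps)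

lemma lobby_value_pair_fun:
  "lobby_value \<pi> f \<alpha> \<sigma> i t l =
    (\<Sum>t'\<in>UNIV. \<Sum>l'\<in>UNIV. bern (\<pi> (other i)) t' * bern (lobby \<sigma> (other i) t') l' *
       continuation_payoff f \<alpha> \<sigma> (GI i) (pair_fun i t t') (pair_fun i l l'))"
  by (simp add: lobby_value_def pair_fun_def)

lemma ex_ante_payoff_pair_fun:
  "ex_ante_payoff \<pi> f \<alpha> \<sigma> j =
    (\<Sum>t\<in>UNIV. \<Sum>l\<in>UNIV. bern (\<pi> i) t * bern (lobby \<sigma> i t) l *
      (\<Sum>t'\<in>UNIV. \<Sum>l'\<in>UNIV. bern (\<pi> (other i)) t' * bern (lobby \<sigma> (other i) t') l' *
       continuation_payoff f \<alpha> \<sigma> j (pair_fun i t t') (pair_fun i l l')))"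
  unfolding ex_ante_payoff_def sum_profile[of _ i] prod_issue[of _ i]
  by (simp add: sum_bool algebra_simps)

lemma ex_ante_payoff_GI:
  "ex_ante_payoff \<pi> f \<alpha> \<sigma> (GI i) =
    (\<Sum>t\<in>UNIV. bern (\<pi> i) t * (\<Sum>l\<in>UNIV. bern (lobby \<sigma> i t) l * lobby_value \<pi> f \<alpha> \<sigma> i t l))"
  unfolding ex_ante_payoff_pair_fun[of _ _ _ _ _ i] lobby_value_pair_fun
  by (simp add: sum_bool algebra_simps)

text \<open>The mixture falls short of a pure action by the weight of the other action times the
  payoff gap, so optimality only constrains actions played with positive probability.\<close>

lemma mixture_optimal_iff:
  fixes q v w :: real
  assumes "q \<in> {0..1}"
  shows "(v \<le> q * v + (1 - q) * w \<and> w \<le> q * v + (1 - q) * w) \<longleftrightarrow>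
    (0 < q \<longrightarrow> w \<le> v) \<and> (q < 1 \<longrightarrow> v \<le> w)"
proof -
  have "v \<le> q * v + (1 - q) * w \<longleftrightarrow> 0 \<le> (1 - q) * (w - v)"
    "w \<le> q * v + (1 - q) * w \<longleftrightarrow> 0 \<le> q * (v - w)"
    by (simp_all add: algebra_simps)
  then show ?thesis using assms by (auto simp: zero_le_mult_iff)
qed

lemma lobby_rational_iff:
  assumes "\<And>i t. lobby \<sigma> i t \<in> {0..1}"
  shows "lobby_rational \<pi> f \<alpha> \<sigma> \<longleftrightarrow>
    (\<forall>i t. (0 < lobby \<sigma> i t \<longrightarrow> lobby_value \<pi> f \<alpha> \<sigma> i t False \<le> lobby_value \<pi> f \<alpha> \<sigma> i t True) \<and>
           (lobby \<sigma> i t < 1 \<longrightarrow> lobby_value \<pi> f \<alpha> \<sigma> i t True \<le> lobby_value \<pi> f \<alpha> \<sigma> i t False))"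
  unfolding lobby_rational_def using mixture_optimal_iff[OF assms]
  by (simp add: all_bool_eq sum_bool)

lemma access_rational_iff:
  assumes "\<And>i. access \<sigma> i \<in> {0..1}" "access \<sigma> Issue1 + access \<sigma> Issue2 = 1"
  shows "access_rational \<alpha> \<sigma> \<longleftrightarrow>
    (\<forall>i. 0 < access \<sigma> i \<longrightarrow> access_value \<alpha> \<sigma> (other i) \<le> access_value \<alpha> \<sigma> i)"
proof -
  have 2: "access \<sigma> Issue2 = 1 - access \<sigma> Issue1" using assms(2) by simp
  then have *: "0 < access \<sigma> Issue2 \<longleftrightarrow> access \<sigma> Issue1 < 1" by simp
  show ?thesis
    unfolding access_rational_def all_issue[of _ Issue1] sum_issue[of _ Issue1]
    using mixture_optimal_iff[OF assms(1)[of Issue1],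
        of "access_value \<alpha> \<sigma> Issue1" "access_value \<alpha> \<sigma> Issue2"] *
    by (simp add: 2)
qed

section \<open>Policy choice issue by issue\<close>

lemma weight_pos: "1 < \<alpha> \<Longrightarrow> 0 < weight \<alpha> i"
  by (simp add: weight_def)

lemma correct_mono_iff: "correct b r \<le> correct b p \<longleftrightarrow> 0 \<le> (2 * b - 1) * (p - r)"
  by (simp add: correct_def algebra_simps)

lemma correct_eq_self: "(2 * b - 1) * (1 - r) = 0 \<Longrightarrow> correct b r = b"
  by (simp add: correct_def algebra_simps)

lemma feasible_two_iff: "feasible_policy 2 r \<longleftrightarrow> (\<forall>i. r i \<in> {0..1})"
  unfolding feasible_policy_def all_issue[of _ Issue1] by auto

text \<open>The bound on the number of reforms does not bind, so deviations can be tested one issue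
  at a time. At belief 1/2 every reform probability is optimal.\<close>

lemma best_response_two_iff:
  assumes "1 < \<alpha>" and p: "\<And>i. p i \<in> {0..1}"
  shows "(\<forall>r. feasible_policy 2 r \<longrightarrow> dp_value \<alpha> b r \<le> dp_value \<alpha> b p) \<longleftrightarrow>
    (\<forall>i. (1/2 < b i \<longrightarrow> p i = 1) \<and> (b i < 1/2 \<longrightarrow> p i = 0))" (is "?L \<longleftrightarrow> ?R")
proof
  assume L: ?L
  have dev: "0 \<le> (2 * b i - 1) * (p i - v)" if "v \<in> {0..1}" for i v
  proof -
    have "dp_value \<alpha> b (p(i := v)) \<le> dp_value \<alpha> b p"
      using L p that by (simp add: feasible_two_iff)
    then have "weight \<alpha> i * correct (b i) v \<le> weight \<alpha> i * correct (b i) (p i)"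
      unfolding dp_value_eq[of _ _ _ i] by simp
    then show ?thesis using weight_pos[OF assms(1), of i] by (simp add: correct_mono_iff)
  qed
  show ?R
  proof (intro allI conjI impI)
    fix i
    show "p i = 1" if "1/2 < b i"
      using dev[of 1 i] that p[of i] by (simp add: zero_le_mult_iff)
    show "p i = 0" if "b i < 1/2"
      using dev[of 0 i] that p[of i] by (simp add: zero_le_mult_iff)
  qed
next
  assume R: ?R
  show ?L
  proof (intro allI impI)
    fix r assume "feasible_policy 2 r"
    then have "correct (b i) (r i) \<le> correct (b i) (p i)" for i
      using R[rule_format, of i] p[of i]
      by (cases "b i" "1/2 :: real" rule: linorder_cases)
        (auto simp: feasible_two_iff correct_mono_iff zero_le_mult_iff mult_le_0_iff)
    then show "dp_value \<alpha> b r \<le> dp_value \<alpha> b p"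
      unfolding dp_value_eq[of _ _ _ Issue1]
      using weight_pos[OF assms(1)] by (intro add_mono mult_left_mono) (auto simp: less_imp_le)
  qed
qed

text \<open>A revealed state is followed, and otherwise only the group's own lobbying matters.
  Arbitrary equilibria with two reforms and the constructed ones are both analysed through this
  form.\<close>

definition policy_form :: "assessment \<Rightarrow> (issue \<Rightarrow> bool \<Rightarrow> real) \<Rightarrow> bool" where
  "policy_form \<sigma> R \<longleftrightarrow> (\<forall>L s i. info_set L s \<longrightarrow>
     policy \<sigma> L s i = (case own_signal s i of Some t \<Rightarrow> of_bool t | None \<Rightarrow> R i (L i)))"

lemma policy_formD:
  "policy_form \<sigma> R \<Longrightarrow> info_set L s \<Longrightarrow>
     policy \<sigma> L s i = (case own_signal s i of Some t \<Rightarrow> of_bool t | None \<Rightarrow> R i (L i))"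
  by (simp add: policy_form_def)

text \<open>The chance that group \<open>i\<close>, if it lobbies, loses access to its rival. Under
  \<open>policy_form\<close> the rival affects issue \<open>i\<close> only through this
  number.\<close>

definition crowded_out :: "(issue \<Rightarrow> real) \<Rightarrow> assessment \<Rightarrow> issue \<Rightarrow> real" where
  "crowded_out \<pi> \<sigma> i = lobby_prob \<pi> \<sigma> (other i) True * access \<sigma> (other i)"

lemma access_other: "access \<sigma> Issue1 + access \<sigma> Issue2 = 1 \<Longrightarrow> access \<sigma> i = 1 - access \<sigma> (other i)"
  by (cases i) simp_all

lemma lobby_value_form:
  assumes "policy_form \<sigma> R" and a: "access \<sigma> Issue1 + access \<sigma> Issue2 = 1"
  shows "lobby_value \<pi> f \<alpha> \<sigma> i t True =
      (1 - crowded_out \<pi> \<sigma> i) * of_bool t + crowded_out \<pi> \<sigma> i * R i True - f i"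
    and "lobby_value \<pi> f \<alpha> \<sigma> i t False = R i False"
  unfolding lobby_value_pair_fun sum_bool continuation_payoff_eq[of _ _ _ _ _ _ i] crowded_out_def
    lobby_prob_eq access_other[OF a, of i]
  using policy_formD[OF assms(1)]
  by (simp_all add: Let_def algebra_simps)

text \<open>Access settles the issue of the chosen group for certain, whatever was believed about
  it; only the other issue is still decided on a belief.\<close>

lemma access_value_form:
  assumes "policy_form \<sigma> R"
  shows "access_value \<alpha> \<sigma> i =
    weight \<alpha> i + weight \<alpha> (other i) * correct (belief \<sigma> (other i) True) (R (other i) True)"
  unfolding access_value_def sum_bool dp_value_eq[of _ _ _ i] final_belief_def
  using policy_formD[OF assms]
  by (simp add: correct_def algebra_simps)

text \<open>The ex ante probability that the decision on issue \<open>i\<close> matches its state,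
  split by state and lobbying decision.\<close>

definition accuracy :: "(issue \<Rightarrow> real) \<Rightarrow> assessment \<Rightarrow> (issue \<Rightarrow> bool \<Rightarrow> real) \<Rightarrow> issue \<Rightarrow> real" where
  "accuracy \<pi> \<sigma> R i =
     \<pi> i * (lobby \<sigma> i True * (1 - crowded_out \<pi> \<sigma> i * (1 - R i True))
       + (1 - lobby \<sigma> i True) * R i False)
     + (1 - \<pi> i) * (lobby \<sigma> i False * (1 - crowded_out \<pi> \<sigma> i * R i True)
       + (1 - lobby \<sigma> i False) * (1 - R i False))"

lemma ex_ante_DP_form:
  assumes "policy_form \<sigma> R" and a: "access \<sigma> Issue1 + access \<sigma> Issue2 = 1"
  shows "ex_ante_payoff \<pi> f \<alpha> \<sigma> DP = \<alpha> * accuracy \<pi> \<sigma> R Issue1 + accuracy \<pi> \<sigma> R Issue2"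
proof -
  have a2: "access \<sigma> Issue2 = 1 - access \<sigma> Issue1" using a by simp
  show ?thesis
    unfolding ex_ante_payoff_pair_fun[of _ _ _ _ _ Issue1] sum_bool
      continuation_payoff_eq[of _ _ _ _ _ _ Issue1] payoff_DP_eq[of _ _ _ _ _ Issue1]
      expected_u_eq
    using policy_formD[OF assms(1)] own_signal_simps(3,4)[of Issue1] own_signal_simps(3,4)[of Issue2]
    by (simp add: Let_def a2 weight_def accuracy_def crowded_out_def lobby_prob_eq algebra_simps)
qed

section \<open>Equilibria with two reforms\<close>

locale lobbying =
  fixes \<pi> f :: "issue \<Rightarrow> real" and \<alpha> :: real
  assumes prior: "\<And>i. 0 < \<pi> i" "\<And>i. \<pi> i < 1/2"
    and cost: "\<And>i. 0 < f i" "\<And>i. f i < 1"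
    and alpha: "1 < \<alpha>"
begin

text \<open>The inequality of the theorem with its positive denominator cleared.\<close>

definition cheap_lobbying :: bool where
  "cheap_lobbying \<longleftrightarrow>
    \<alpha> * \<pi> Issue1 * f Issue1 + (2 * \<alpha> - 1) * \<pi> Issue2 * f Issue2 \<le> \<pi> Issue1 * \<pi> Issue2"

text \<open>Both coefficients \<open>\<alpha>\<close> and \<open>2 * \<alpha> - 1\<close> exceed 1.
  The weaker bound obtained is exactly what excludes truthful lobbying with two reforms.\<close>

lemma cheap_lobbying_cost:
  assumes cheap_lobbying
  shows "\<pi> Issue1 * f Issue1 + \<pi> Issue2 * f Issue2 < \<pi> Issue1 * \<pi> Issue2"
proof -
  have "\<pi> Issue1 * f Issue1 < \<alpha> * (\<pi> Issue1 * f Issue1)"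
    "\<pi> Issue2 * f Issue2 < (2 * \<alpha> - 1) * (\<pi> Issue2 * f Issue2)"
    using alpha prior cost by simp_all
  then show ?thesis using assms unfolding cheap_lobbying_def by simp
qed

lemma cheap_lobbying_cost_less:
  assumes cheap_lobbying
  shows "f i < \<pi> (other i)"
proof -
  have pos: "0 < \<pi> k * f k" for k using prior(1) cost(1) by simp
  have "\<pi> i * f i < \<pi> i * \<pi> (other i)"
    using cheap_lobbying_cost[OF assms] pos[of Issue1] pos[of Issue2]
      mult.commute[of "\<pi> Issue1" "\<pi> Issue2"]
    by (cases i; simp only: other.simps; linarith)
  then show ?thesis using prior(1)[of i] by simp
qed

lemma cheap_lobbying_cost_half: "cheap_lobbying \<Longrightarrow> f i < 1 - \<pi> (other i)"
  using cheap_lobbying_cost_less[of i] prior(2)[of "other i"] by simp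

lemma equilibrium_lobby:
  assumes "equilibrium \<pi> f \<alpha> N \<sigma>"
  shows "0 \<le> lobby \<sigma> i t" "lobby \<sigma> i t \<le> 1"
    and "0 < lobby \<sigma> i t \<Longrightarrow> lobby_value \<pi> f \<alpha> \<sigma> i t False \<le> lobby_value \<pi> f \<alpha> \<sigma> i t True"
    and "lobby \<sigma> i t < 1 \<Longrightarrow> lobby_value \<pi> f \<alpha> \<sigma> i t True \<le> lobby_value \<pi> f \<alpha> \<sigma> i t False"
proof -
  have l: "lobby \<sigma> i t \<in> {0..1}" for i t
    using assms by (simp add: equilibrium_def valid_strategies_def)
  show "0 \<le> lobby \<sigma> i t" "lobby \<sigma> i t \<le> 1" using l by auto
  show "0 < lobby \<sigma> i t \<Longrightarrow> lobby_value \<pi> f \<alpha> \<sigma> i t False \<le> lobby_value \<pi> f \<alpha> \<sigma> i t True"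
    "lobby \<sigma> i t < 1 \<Longrightarrow> lobby_value \<pi> f \<alpha> \<sigma> i t True \<le> lobby_value \<pi> f \<alpha> \<sigma> i t False"
    using assms lobby_rational_iff[OF l] by (auto simp: equilibrium_def)
qed

lemma equilibrium_access:
  assumes "equilibrium \<pi> f \<alpha> N \<sigma>"
  shows "0 \<le> access \<sigma> i" "access \<sigma> i \<le> 1" "access \<sigma> Issue1 + access \<sigma> Issue2 = 1"
    and "0 < access \<sigma> i \<Longrightarrow> access_value \<alpha> \<sigma> (other i) \<le> access_value \<alpha> \<sigma> i"
proof -
  have a: "\<And>i. access \<sigma> i \<in> {0..1}" "access \<sigma> Issue1 + access \<sigma> Issue2 = 1"
    using assms by (auto simp: equilibrium_def valid_strategies_def)
  then show "0 \<le> access \<sigma> i" "access \<sigma> i \<le> 1" "access \<sigma> Issue1 + access \<sigma> Issue2 = 1" by auto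
  show "0 < access \<sigma> i \<Longrightarrow> access_value \<alpha> \<sigma> (other i) \<le> access_value \<alpha> \<sigma> i"
    using assms access_rational_iff[OF a] by (simp add: equilibrium_def)
qed

lemma lobby_prob_bounds:
  assumes "equilibrium \<pi> f \<alpha> N \<sigma>"
  shows "0 \<le> lobby_prob \<pi> \<sigma> i True" "lobby_prob \<pi> \<sigma> i True \<le> 1"
proof -
  note x = equilibrium_lobby(1,2)[OF assms, of i True]
    and y = equilibrium_lobby(1,2)[OF assms, of i False]
  show "0 \<le> lobby_prob \<pi> \<sigma> i True"
    using x y prior[of i] by (simp add: lobby_prob_eq)
  have "\<pi> i * lobby \<sigma> i True + (1 - \<pi> i) * lobby \<sigma> i False \<le> \<pi> i * 1 + (1 - \<pi> i) * 1"
    using x y prior[of i] by (intro add_mono mult_left_mono) auto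
  then show "lobby_prob \<pi> \<sigma> i True \<le> 1" by (simp add: lobby_prob_eq)
qed

lemma equilibrium_belief:
  assumes "equilibrium \<pi> f \<alpha> N \<sigma>"
  shows "0 \<le> belief \<sigma> i l" "belief \<sigma> i l \<le> 1"
    and "lobby_prob \<pi> \<sigma> i l > 0 \<Longrightarrow> belief \<sigma> i l * lobby_prob \<pi> \<sigma> i l = \<pi> i * bern (lobby \<sigma> i True) l"
  using assms by (auto simp: equilibrium_def bayes_consistent_def)

lemma equilibrium_policy:
  assumes "equilibrium \<pi> f \<alpha> N \<sigma>" "info_set L s"
  shows "feasible_policy N (policy \<sigma> L s)"
    and "feasible_policy N r \<Longrightarrow>
      dp_value \<alpha> (final_belief \<sigma> L s) r \<le> dp_value \<alpha> (final_belief \<sigma> L s) (policy \<sigma> L s)"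
  using assms by (auto simp: equilibrium_def valid_strategies_def policy_rational_def)

text \<open>Silence is no good news: if the high type always lobbies, the posterior is 0; if the low
  type never does, it is at most the prior, hence below 1/2.\<close>

lemma silence_belief_less_half:
  assumes "equilibrium \<pi> f \<alpha> N \<sigma>" "lobby \<sigma> i True = 1 \<or> lobby \<sigma> i False = 0"
    and "lobby_prob \<pi> \<sigma> i True < 1"
  shows "belief \<sigma> i False < 1/2"
proof -
  have b: "belief \<sigma> i False * (1 - lobby_prob \<pi> \<sigma> i True) = \<pi> i * (1 - lobby \<sigma> i True)"
    using equilibrium_belief(3)[OF assms(1), of i False] assms(3) by (simp add: lobby_prob_eq(2))
  show ?thesis
  proof (cases "lobby \<sigma> i True = 1")
    case True
    then show ?thesis using b assms(3) by simp
  next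
    case False
    then have 0: "lobby \<sigma> i False = 0" using assms(2) by simp
    have "0 \<le> \<pi> i * lobby \<sigma> i True"
      using equilibrium_lobby(1)[OF assms(1)] prior(1)[of i] by simp
    then have "2 * (\<pi> i * (1 - lobby \<sigma> i True)) < 1 - lobby_prob \<pi> \<sigma> i True"
      using prior(2)[of i] by (simp add: lobby_prob_eq 0 algebra_simps)
    then have "(2 * belief \<sigma> i False) * (1 - lobby_prob \<pi> \<sigma> i True) < 1 * (1 - lobby_prob \<pi> \<sigma> i True)"
      using b by simp
    then show ?thesis using assms(3) by simp
  qed
qed

lemma truthful_belief:
  assumes "equilibrium \<pi> f \<alpha> N \<sigma>" "lobby \<sigma> i False = 0" "0 < lobby \<sigma> i True"
  shows "belief \<sigma> i True = 1"
  using equilibrium_belief(3)[OF assms(1), of i True] assms prior[of i] by (simp add: lobby_prob_eq)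

end

section \<open>Policy and lobbying in an equilibrium with two reforms\<close>

locale two_reforms = lobbying +
  fixes \<tau> :: assessment
  assumes eq: "equilibrium \<pi> f \<alpha> 2 \<tau>"
begin

text \<open>
  The two information sets below represent all those at which issue \<open>i\<close> sends no signal; by
  \<open>issuewise_policy\<close> the choice does not matter.
\<close>

definition R :: "issue \<Rightarrow> bool \<Rightarrow> real" where
  "R i l = (if l then policy \<tau> (\<lambda>_. True) (Some (other i, True)) i else policy \<tau> (\<lambda>_. False) None i)"

lemma policy_two:
  assumes "info_set L s"
  shows "0 \<le> policy \<tau> L s i" "policy \<tau> L s i \<le> 1"
    and "1/2 < final_belief \<tau> L s i \<Longrightarrow> policy \<tau> L s i = 1"
    and "final_belief \<tau> L s i < 1/2 \<Longrightarrow> policy \<tau> L s i = 0"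
proof -
  have p: "policy \<tau> L s i \<in> {0..1}" for i
    using equilibrium_policy(1)[OF eq assms] by (simp add: feasible_two_iff)
  then show "0 \<le> policy \<tau> L s i" "policy \<tau> L s i \<le> 1" by auto
  show "1/2 < final_belief \<tau> L s i \<Longrightarrow> policy \<tau> L s i = 1"
    "final_belief \<tau> L s i < 1/2 \<Longrightarrow> policy \<tau> L s i = 0"
    using best_response_two_iff[of \<alpha> "policy \<tau> L s" "final_belief \<tau> L s", OF alpha p]
      equilibrium_policy(2)[OF eq assms] by auto
qed

text \<open>Revealed states give beliefs 0 or 1, away from the threshold. Without a signal,
  \<open>issuewise_policy\<close> transfers the choice from a representative information
  set.\<close>

lemma form: "policy_form \<tau> R"
  unfolding policy_form_def
proof (intro allI impI)
  fix L s i assume I: "info_set L s"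
  show "policy \<tau> L s i = (case own_signal s i of Some t \<Rightarrow> of_bool t | None \<Rightarrow> R i (L i))"
  proof (cases "own_signal s i")
    case (Some t)
    then show ?thesis
      using policy_two(3,4)[OF I, of i] by (cases t) (simp_all add: final_belief_def)
  next
    case None
    have "issuewise_policy \<tau>" using eq by (simp add: equilibrium_def valid_strategies_def)
    then have "policy \<tau> L s i = policy \<tau> L' s' i"
      if "info_set L' s'" "L' i = L i" "own_signal s' i = None" for L' s'
      using I None that unfolding issuewise_policy_def by metis
    from this[of "\<lambda>_. L i" "if L i then Some (other i, True) else None"] None
    show ?thesis by (simp add: R_def split: if_splits)
  qed
qed

lemma R_bounds: "0 \<le> R i l" "R i l \<le> 1"
  unfolding R_def by (auto intro!: policy_two)

lemma R_belief: "1/2 < belief \<tau> i l \<Longrightarrow> R i l = 1" "belief \<tau> i l < 1/2 \<Longrightarrow> R i l = 0"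
  using policy_two(3,4)[of "\<lambda>_. True" "Some (other i, True)" i] policy_two(3,4)[of "\<lambda>_. False" None i]
  by (cases l; simp add: R_def final_belief_def)+

abbreviation x where "x i \<equiv> lobby \<tau> i True"
abbreviation y where "y i \<equiv> lobby \<tau> i False"
abbreviation \<Lambda> where "\<Lambda> i \<equiv> lobby_prob \<pi> \<tau> i True"
abbreviation B where "B i \<equiv> belief \<tau> i True"
abbreviation c where "c i \<equiv> crowded_out \<pi> \<tau> i"
abbreviation g where "g i \<equiv> access \<tau> i"

lemmas g_sum = equilibrium_access(3)[OF eq]
lemmas value_form = lobby_value_form[OF form g_sum]
lemmas x_bounds = equilibrium_lobby(1,2)[OF eq, of _ True]
lemmas y_bounds = equilibrium_lobby(1,2)[OF eq, of _ False]

lemma incentives: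
  "0 < x i \<Longrightarrow> R i False \<le> 1 - c i + c i * R i True - f i"
  "x i < 1 \<Longrightarrow> 1 - c i + c i * R i True - f i \<le> R i False"
  "0 < y i \<Longrightarrow> R i False \<le> c i * R i True - f i"
  "y i < 1 \<Longrightarrow> c i * R i True - f i \<le> R i False"
  using equilibrium_lobby(3,4)[OF eq, of i] by (force simp: value_form)+

text \<open>If both types lobbied for sure, the belief would stay at the prior, below 1/2. There
  would be no reform without access, and the low type would pay the cost for nothing.\<close>

lemma \<Lambda>_less_1: "\<Lambda> i < 1"
proof (rule ccontr)
  assume "\<not> \<Lambda> i < 1"
  then have "\<pi> i * (1 - x i) + (1 - \<pi> i) * (1 - y i) \<le> 0"
    by (simp add: lobby_prob_eq algebra_simps)
  moreover have "0 \<le> \<pi> i * (1 - x i)" "0 \<le> (1 - \<pi> i) * (1 - y i)"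
    using x_bounds y_bounds prior[of i] by simp_all
  ultimately have "\<pi> i * (1 - x i) = 0" "(1 - \<pi> i) * (1 - y i) = 0" by linarith+
  then have xy: "x i = 1" "y i = 1" using prior[of i] by auto
  then have "B i = \<pi> i" using equilibrium_belief(3)[OF eq, of i True] by (simp add: lobby_prob_eq)
  then have "R i True = 0" using R_belief(2) prior by simp
  then show False using incentives(3)[of i] xy R_bounds(1)[of i False] cost(1)[of i] by simp
qed

lemma c_bounds: "0 \<le> c i" "c i \<le> \<Lambda> (other i)" "c i < 1"
proof -
  show "0 \<le> c i" "c i \<le> \<Lambda> (other i)"
    using lobby_prob_bounds[OF eq] equilibrium_access[OF eq]
    by (simp_all add: crowded_out_def mult_left_le)
  then show "c i < 1" using \<Lambda>_less_1[of "other i"] by simp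
qed

text \<open>Single crossing: silence pays both types the same, while lobbying pays the high type
  more by \<open>1 - c i > 0\<close>.\<close>

lemma low_type_waits: "x i < 1 \<Longrightarrow> y i = 0"
  using incentives(2,3)[of i] c_bounds(3)[of i] y_bounds(1)[of i] by fastforce

lemma R_silent: "R i False = 0"
  using silence_belief_less_half[OF eq _ \<Lambda>_less_1, of i] low_type_waits[of i] x_bounds[of i] R_belief(2)
  by fastforce

text \<open>Next to a mixing high type the low type stays silent, so lobbying is fully believed. It
  then yields \<open>1 - f i > 0\<close> against 0 from silence, which excludes mixing.\<close>

lemma active_or_silent: "x i = 1 \<or> x i = 0 \<and> y i = 0"
proof (rule ccontr)
  assume "\<not> ?thesis"
  then have "0 < x i" "x i < 1" "y i = 0"
    using low_type_waits[of i] x_bounds[of i] by fastforce+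
  moreover then have "R i True = 1" using truthful_belief[OF eq] R_belief(1)[of i True] by simp
  ultimately show False using incentives(2)[of i] R_silent[of i] cost(2)[of i] by simp
qed

section \<open>A group whose high type lobbies for sure\<close>

context
  fixes i
  assumes active: "x i = 1"
begin

lemma \<Lambda>_eq: "\<Lambda> i = \<pi> i + (1 - \<pi> i) * y i"
  by (simp add: lobby_prob_eq active)

lemma \<Lambda>_ge: "\<pi> i \<le> \<Lambda> i"
  using y_bounds prior[of i] by (simp add: \<Lambda>_eq)

lemma \<Lambda>_pos: "0 < \<Lambda> i"
  using \<Lambda>_ge prior(1)[of i] by simp

lemma B_\<Lambda>: "B i * \<Lambda> i = \<pi> i"
  using equilibrium_belief(3)[OF eq, of i True] \<Lambda>_pos active by simp

lemma low_type_incentive: "c i * R i True \<le> f i"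
proof -
  have "(1 - \<pi> i) * y i < 1 - \<pi> i" using \<Lambda>_less_1[of i] unfolding \<Lambda>_eq by linarith
  then have "y i < 1" using prior(2)[of i] by simp
  then show ?thesis using incentives(4)[of i] R_silent by simp
qed

lemma low_type_indifferent:
  assumes "\<pi> i < \<Lambda> i"
  shows "c i * R i True = f i"
proof -
  have "0 < (1 - \<pi> i) * y i" using assms unfolding \<Lambda>_eq by linarith
  then have "0 < y i" using prior(2)[of i] by (simp add: zero_less_mult_iff)
  then show ?thesis using incentives(3)[of i] R_silent low_type_incentive by simp
qed

text \<open>A belief below 1/2 needs low types who lobby, but then no reform follows without access
  and these low types only lose the cost. At 1/2, Bayes' rule fixes the lobbying
  probability.\<close>

lemma B_cases: "1/2 < B i \<and> R i True = 1 \<or> B i = 1/2 \<and> \<Lambda> i = 2 * \<pi> i"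
proof (cases "B i" "1/2 :: real" rule: linorder_cases)
  case less
  then have "R i True = 0" by (rule R_belief)
  moreover have "\<pi> i < \<Lambda> i" using B_\<Lambda> less mult_strict_right_mono[OF less \<Lambda>_pos] \<Lambda>_pos by simp
  ultimately show ?thesis using low_type_indifferent cost(1)[of i] by simp
next
  case equal
  then have "\<Lambda> i = 2 * (B i * \<Lambda> i)" by simp
  then have "\<Lambda> i = 2 * \<pi> i" unfolding B_\<Lambda> .
  then show ?thesis using equal by simp
qed (use R_belief(1) in auto)

lemma correct_B: "correct (B i) (R i True) = B i"
  by (rule correct_eq_self) (use B_cases in auto)

text \<open>Errors occur only when the lobbying group loses access. With \<open>R i True = 1\<close>
  they are the lobbying low types; at belief 1/2 reforming and not reforming err equally often, so
  the same mass results.\<close>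

lemma accuracy_active: "accuracy \<pi> \<tau> R i = 1 - c i * (\<Lambda> i - \<pi> i)"
proof -
  have "accuracy \<pi> \<tau> R i = 1 - c i * (\<pi> i * (1 - R i True) + (\<Lambda> i - \<pi> i) * R i True)"
    by (simp add: accuracy_def active R_silent \<Lambda>_eq algebra_simps)
  also have "\<pi> i * (1 - R i True) + (\<Lambda> i - \<pi> i) * R i True = \<Lambda> i - \<pi> i"
    using B_cases by (auto simp: algebra_simps)
  finally show ?thesis .
qed

text \<open>The low type earns nothing: it either stays silent or is indifferent to silence, which
  pays 0.\<close>

lemma payoff_active:
  "ex_ante_payoff \<pi> f \<alpha> \<tau> (GI i) = \<pi> i * (1 - c i * (1 - R i True) - f i)"
proof -
  have 0: "y i * (c i * R i True - f i) = 0"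
    using low_type_indifferent \<Lambda>_ge prior[of i] by (fastforce simp: \<Lambda>_eq)
  have "ex_ante_payoff \<pi> f \<alpha> \<tau> (GI i) = \<pi> i * (1 - c i * (1 - R i True) - f i)
     + (1 - \<pi> i) * (y i * (c i * R i True - f i))"
    unfolding ex_ante_payoff_GI sum_bool value_form R_silent by (simp add: active algebra_simps)
  then show ?thesis using 0 by simp
qed

lemma payoff_active_pos: "0 < ex_ante_payoff \<pi> f \<alpha> \<tau> (GI i)"
proof -
  have "c i * (1 - R i True) < 1 - f i"
    using B_cases
  proof
    assume "B i = 1/2 \<and> \<Lambda> i = 2 * \<pi> i"
    then have "c i * R i True = f i" using low_type_indifferent prior(1)[of i] by simp
    then show ?thesis using c_bounds(3)[of i] by (simp add: algebra_simps)
  qed (use cost(2) in auto)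
  then show ?thesis using prior(1)[of i] by (simp add: payoff_active)
qed

end

section \<open>A group whose high type does not lobby for sure\<close>

context
  fixes i
  assumes silent: "x i \<noteq> 1"
begin

lemma xy_silent: "x i = 0" "y i = 0" "\<Lambda> i = 0" "c (other i) = 0"
  using silent active_or_silent[of i] by (auto simp: lobby_prob_eq crowded_out_def)

text \<open>With no competitor the rival is never crowded out: its high type gains
  \<open>1 - f (other i)\<close>, and its low type would always be exposed.\<close>

lemma rival_truthful: "x (other i) = 1" "y (other i) = 0" "\<Lambda> (other i) = \<pi> (other i)"
proof -
  show x: "x (other i) = 1"
    using incentives(2)[of "other i"] xy_silent R_silent[of "other i"] cost(2)[of "other i"]
      x_bounds(2)[of "other i"] by fastforce
  show "\<Lambda> (other i) = \<pi> (other i)"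
    using low_type_indifferent[OF x] \<Lambda>_ge[OF x] cost(1)[of "other i"] xy_silent(4) by fastforce
  then show "y (other i) = 0" using prior(2)[of "other i"] by (simp add: \<Lambda>_eq[OF x])
qed

text \<open>By deviating, the high type obtains access at least whenever the truthful rival is
  silent.\<close>

lemma silent_cost: "1 - \<pi> (other i) \<le> f i"
  using incentives(2)[of i] xy_silent R_silent[of i] c_bounds(1,2)[of i]
    mult_nonneg_nonneg[OF c_bounds(1) R_bounds(1), of i i True]
  by (simp add: rival_truthful)

lemma payoffs_silent:
  "ex_ante_payoff \<pi> f \<alpha> \<tau> (GI i) = 0"
  "ex_ante_payoff \<pi> f \<alpha> \<tau> (GI (other i)) = \<pi> (other i) * (1 - f (other i))"
  "ex_ante_payoff \<pi> f \<alpha> \<tau> DP = weight \<alpha> i * (1 - \<pi> i) + weight \<alpha> (other i)"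
proof -
  show "ex_ante_payoff \<pi> f \<alpha> \<tau> (GI i) = 0"
    unfolding ex_ante_payoff_GI sum_bool value_form R_silent by (simp add: xy_silent)
  show "ex_ante_payoff \<pi> f \<alpha> \<tau> (GI (other i)) = \<pi> (other i) * (1 - f (other i))"
    by (simp add: payoff_active[OF rival_truthful(1)] xy_silent)
  have "accuracy \<pi> \<tau> R i = 1 - \<pi> i" "accuracy \<pi> \<tau> R (other i) = 1"
    by (simp_all add: accuracy_def xy_silent rival_truthful R_silent)
  then show "ex_ante_payoff \<pi> f \<alpha> \<tau> DP = weight \<alpha> i * (1 - \<pi> i) + weight \<alpha> (other i)"
    unfolding ex_ante_DP_form[OF form g_sum] by (cases i) (simp_all add: weight_def)
qed

end

section \<open>Both high types lobby for sure\<close>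

context
  assumes both_active: "\<And>i. x i = 1"
begin

text \<open>Access removes the weighted error \<open>1 - B\<close> that would remain on that issue,
  so it goes where this error is largest.\<close>

lemma access_active:
  assumes "0 < g i"
  shows "weight \<alpha> (other i) * (1 - B (other i)) \<le> weight \<alpha> i * (1 - B i)"
  using equilibrium_access(4)[OF eq assms]
  by (simp add: access_value_form[OF form] correct_B[OF both_active] algebra_simps)

text \<open>A lobbying low type profits only from being crowded out, so the rival sometimes gets
  access. That is optimal only if the rival's issue is uncertain too, that is, if its low type also
  lobbies.\<close>

lemma noisy_step:
  assumes "\<pi> i < \<Lambda> i"
  shows "0 < g (other i)" "\<pi> (other i) < \<Lambda> (other i)"
proof -
  have "c i \<noteq> 0" using low_type_indifferent[OF both_active assms] cost(1)[of i] by auto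
  then show g: "0 < g (other i)"
    using equilibrium_access(1)[OF eq, of "other i"] by (fastforce simp: crowded_out_def)
  have "B i \<noteq> 1" using B_\<Lambda>[OF both_active, of i] assms by auto
  then have "B i < 1" using equilibrium_belief(2)[OF eq, of i True] by simp
  then have "0 < weight \<alpha> i * (1 - B i)" using weight_pos[OF alpha] by simp
  also have "\<dots> \<le> weight \<alpha> (other i) * (1 - B (other i))" using access_active[OF g] by simp
  finally have "B (other i) \<noteq> 1" by auto
  then have "\<Lambda> (other i) \<noteq> \<pi> (other i)"
    using B_\<Lambda>[OF both_active, of "other i"] prior(1)[of "other i"] by auto
  then show "\<pi> (other i) < \<Lambda> (other i)"
    using \<Lambda>_ge[OF both_active, of "other i"] by simp
qed

lemma noisy_all: "\<pi> i < \<Lambda> i \<Longrightarrow> \<pi> k < \<Lambda> k"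
  using noisy_step(2) issue_cases[of k i] by metis

text \<open>Deterring the low types needs \<open>\<pi> (other i) * g (other i) \<le> f i\<close>.
  Weighting by \<open>\<pi> i\<close> and summing eliminates the access rule because the access
  probabilities add up to 1.\<close>

lemma truthful_cost:
  assumes "\<And>i. \<Lambda> i = \<pi> i"
  shows "\<pi> Issue1 * \<pi> Issue2 \<le> \<pi> Issue1 * f Issue1 + \<pi> Issue2 * f Issue2"
proof -
  have "R i True = 1" for i
    using B_cases[OF both_active, of i] assms[of i] prior(1)[of i] by simp
  then have "\<pi> (other i) * g (other i) \<le> f i" for i
    using low_type_incentive[OF both_active, of i] by (simp add: crowded_out_def assms)
  from this[of Issue1] this[of Issue2]
  have "\<pi> Issue1 * (\<pi> Issue2 * g Issue2) + \<pi> Issue2 * (\<pi> Issue1 * g Issue1)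
      \<le> \<pi> Issue1 * f Issue1 + \<pi> Issue2 * f Issue2"
    using prior(1)[of Issue1] prior(1)[of Issue2] by (intro add_mono mult_left_mono) simp_all
  also have "\<pi> Issue1 * (\<pi> Issue2 * g Issue2) + \<pi> Issue2 * (\<pi> Issue1 * g Issue1)
      = \<pi> Issue1 * \<pi> Issue2 * (g Issue1 + g Issue2)"
    by (simp add: algebra_simps)
  finally show ?thesis by (simp add: g_sum)
qed

section \<open>Both low types lobby with positive probability\<close>

context
  assumes noisy: "\<And>i. \<pi> i < \<Lambda> i"
begin

lemma access_indifferent: "\<alpha> * (1 - B Issue1) = 1 - B Issue2"
proof -
  have "0 < g i" for i using noisy_step(1)[OF noisy, of "other i"] by simp
  from access_active[OF this[of Issue1]] access_active[OF this[of Issue2]]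
  show ?thesis by (simp add: weight_def)
qed

lemma indifferent: "c i * R i True = f i"
  by (rule low_type_indifferent[OF both_active noisy])

text \<open>Since \<open>\<alpha> > 1\<close>, access indifference makes the residual error on issue
  1 strictly smaller than that on issue 2, which is at most 1/2.\<close>

lemma R_Issue1: "R Issue1 True = 1"
proof -
  have "0 \<noteq> 1 - B Issue1"
    using B_\<Lambda>[OF both_active, of Issue1] noisy[of Issue1] by auto
  then have "1 - B Issue1 < \<alpha> * (1 - B Issue1)"
    using alpha equilibrium_belief(2)[OF eq, of Issue1 True] by simp
  also have "\<dots> \<le> 1/2" using access_indifferent B_cases[OF both_active, of Issue2] by auto
  finally show ?thesis using B_cases[OF both_active, of Issue1] by auto
qed

lemma c_eq: "c Issue1 = \<Lambda> Issue2 * (1 - g Issue1)" "c Issue2 = \<Lambda> Issue1 * g Issue1"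
proof -
  have "1 - g Issue1 = g Issue2" using g_sum by simp
  then show "c Issue1 = \<Lambda> Issue2 * (1 - g Issue1)" "c Issue2 = \<Lambda> Issue1 * g Issue1"
    by (simp_all add: crowded_out_def)
qed

text \<open>If lobbying without access always led to reform, the indifference conditions would
  combine to \<open>f1 * \<Lambda>1 + f2 * \<Lambda>2 = \<Lambda>1 * \<Lambda>2\<close>. Multiplying
  by both beliefs and using Bayes' rule contradicts the cost bound, as beliefs are at most
  1.\<close>

lemma R_Issue2_less_1:
  assumes "\<pi> Issue1 * f Issue1 + \<pi> Issue2 * f Issue2 < \<pi> Issue1 * \<pi> Issue2"
  shows "R Issue2 True < 1"
proof (rule ccontr)
  assume "\<not> ?thesis"
  then have R2: "R Issue2 True = 1" using R_bounds(2)[of Issue2 True] by simp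
  have f: "f Issue1 = \<Lambda> Issue2 * (1 - g Issue1)" "f Issue2 = \<Lambda> Issue1 * g Issue1"
    using indifferent[of Issue1] indifferent[of Issue2] by (simp_all add: R2 R_Issue1 c_eq)
  have "f Issue1 * \<Lambda> Issue1 + f Issue2 * \<Lambda> Issue2 = \<Lambda> Issue1 * \<Lambda> Issue2"
    unfolding f by (simp add: algebra_simps)
  then have "B Issue1 * B Issue2 * (f Issue1 * \<Lambda> Issue1 + f Issue2 * \<Lambda> Issue2)
    = (B Issue1 * \<Lambda> Issue1) * (B Issue2 * \<Lambda> Issue2)" by simp
  moreover have "B Issue1 * B Issue2 * (f Issue1 * \<Lambda> Issue1 + f Issue2 * \<Lambda> Issue2)
    = (B Issue1 * \<Lambda> Issue1) * f Issue1 * B Issue2 + (B Issue2 * \<Lambda> Issue2) * f Issue2 * B Issue1"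
    by (simp add: algebra_simps)
  ultimately have "\<pi> Issue1 * f Issue1 * B Issue2 + \<pi> Issue2 * f Issue2 * B Issue1
    = \<pi> Issue1 * \<pi> Issue2" by (simp add: B_\<Lambda>[OF both_active])
  moreover have "\<pi> Issue1 * f Issue1 * B Issue2 \<le> \<pi> Issue1 * f Issue1"
    "\<pi> Issue2 * f Issue2 * B Issue1 \<le> \<pi> Issue2 * f Issue2"
    using prior(1) cost(1) equilibrium_belief(2)[OF eq] by (simp_all add: mult_left_le less_imp_le)
  ultimately show False using assms by linarith
qed

lemma half_beliefs:
  assumes "R Issue2 True < 1"
  shows "\<Lambda> Issue2 = 2 * \<pi> Issue2" "(2 * \<alpha> - 1) * \<Lambda> Issue1 = 2 * \<alpha> * \<pi> Issue1"
proof -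
  have B2: "B Issue2 = 1/2" and "\<Lambda> Issue2 = 2 * \<pi> Issue2"
    using B_cases[OF both_active, of Issue2] assms by auto
  then show "\<Lambda> Issue2 = 2 * \<pi> Issue2" by simp
  have e: "2 * \<alpha> - 1 = 2 * \<alpha> * B Issue1"
    using access_indifferent B2 unfolding right_diff_distrib by linarith
  have "(2 * \<alpha> - 1) * \<Lambda> Issue1 = 2 * \<alpha> * (B Issue1 * \<Lambda> Issue1)" by (simp only: e mult.assoc)
  then show "(2 * \<alpha> - 1) * \<Lambda> Issue1 = 2 * \<alpha> * \<pi> Issue1" by (simp add: B_\<Lambda>[OF both_active])
qed

text \<open>The left side compares the losses of group 2's high type: from being crowded out with
  two reforms, and from yielding to issue 1, with probability \<open>\<pi> Issue1\<close>, with one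
  reform. All quantities are determined, so the comparison is exact.\<close>

lemma rent_iff:
  assumes "R Issue2 True < 1"
  shows "\<pi> Issue1 \<le> c Issue2 * (1 - R Issue2 True) \<longleftrightarrow> cheap_lobbying"
proof -
  note h = half_beliefs[OF assms]
  \<comment> \<open>This factor clears the denominators of \<open>\<Lambda> Issue1 = 2 * \<alpha> *
    \<pi> Issue1 / (2 * \<alpha> - 1)\<close> and
    \<open>g Issue1 = 1 - f Issue1 / (2 * \<pi> Issue2)\<close>.\<close>
  have scale: "0 < 2 * \<pi> Issue2 * (2 * \<alpha> - 1)" using prior(1)[of Issue2] alpha by simp
  have "2 * \<pi> Issue2 * (1 - g Issue1) = f Issue1"
    using indifferent[of Issue1] by (simp add: R_Issue1 c_eq h(1))
  then have g1: "2 * \<pi> Issue2 * g Issue1 = 2 * \<pi> Issue2 - f Issue1"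
    unfolding right_diff_distrib by linarith
  have "2 * \<pi> Issue2 * (2 * \<alpha> - 1) * c Issue2
      = ((2 * \<alpha> - 1) * \<Lambda> Issue1) * (2 * \<pi> Issue2 * g Issue1)" by (simp add: c_eq)
  also have "\<dots> = 2 * \<alpha> * \<pi> Issue1 * (2 * \<pi> Issue2 - f Issue1)" by (simp only: h g1)
  finally have c2: "2 * \<pi> Issue2 * (2 * \<alpha> - 1) * c Issue2 = \<dots>" .
  have "c Issue2 * (1 - R Issue2 True) - \<pi> Issue1 = c Issue2 - f Issue2 - \<pi> Issue1"
    using indifferent[of Issue2] by (simp add: algebra_simps)
  then have "\<pi> Issue1 \<le> c Issue2 * (1 - R Issue2 True) \<longleftrightarrow> 0 \<le> c Issue2 - f Issue2 - \<pi> Issue1"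
    by linarith
  also have "\<dots> \<longleftrightarrow> 0 \<le> 2 * \<pi> Issue2 * (2 * \<alpha> - 1) * (c Issue2 - f Issue2 - \<pi> Issue1)"
    using mult_le_cancel_left_pos[OF scale, of 0 "c Issue2 - f Issue2 - \<pi> Issue1"]
    unfolding mult_zero_right by (rule sym)
  also have "2 * \<pi> Issue2 * (2 * \<alpha> - 1) * (c Issue2 - f Issue2 - \<pi> Issue1)
    = 2 * (\<pi> Issue1 * \<pi> Issue2
        - (\<alpha> * \<pi> Issue1 * f Issue1 + (2 * \<alpha> - 1) * \<pi> Issue2 * f Issue2))"
    using c2 by (simp add: algebra_simps)
  also have "0 \<le> \<dots> \<longleftrightarrow> cheap_lobbying" by (auto simp: cheap_lobbying_def)
  finally show ?thesis .
qed

text \<open>The expected losses on the two issues add up to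
  \<open>\<Lambda> Issue1 * \<pi> Issue2\<close> whatever the access probabilities, and noise makes
  \<open>\<Lambda> Issue1\<close> exceed \<open>\<pi> Issue1\<close>.\<close>

lemma DP_noisy:
  assumes "R Issue2 True < 1"
  shows "ex_ante_payoff \<pi> f \<alpha> \<tau> DP < \<alpha> + 1 - \<pi> Issue1 * \<pi> Issue2"
proof -
  note h = half_beliefs[OF assms]
  have l: "2 * \<alpha> * (\<Lambda> Issue1 - \<pi> Issue1) = \<Lambda> Issue1" using h(2) by (simp add: algebra_simps)
  have "\<alpha> * (c Issue1 * (\<Lambda> Issue1 - \<pi> Issue1))
    = \<pi> Issue2 * (1 - g Issue1) * (2 * \<alpha> * (\<Lambda> Issue1 - \<pi> Issue1))"
    by (simp add: c_eq h(1))
  also have "\<dots> = \<pi> Issue2 * (1 - g Issue1) * \<Lambda> Issue1" by (simp only: l)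
  finally have "ex_ante_payoff \<pi> f \<alpha> \<tau> DP = \<alpha> + 1 - \<Lambda> Issue1 * \<pi> Issue2"
    unfolding ex_ante_DP_form[OF form g_sum] accuracy_active[OF both_active]
    by (simp add: c_eq h(1) algebra_simps)
  then show ?thesis using noisy[of Issue1] prior(1)[of Issue2] by simp
qed

end

text \<open>The bound is group 2's payoff with one reform when both high types lobby. It forces a
  loss from crowding out, hence \<open>R Issue2 True < 1\<close>, belief 1/2 and noise, where
  \<open>rent_iff\<close> applies.\<close>

lemma cheap_if_GI2_better:
  assumes "ex_ante_payoff \<pi> f \<alpha> \<tau> (GI Issue2) \<le> \<pi> Issue2 * (1 - \<pi> Issue1 - f Issue2)"
  shows cheap_lobbying
proof -
  have p: "\<pi> Issue1 \<le> c Issue2 * (1 - R Issue2 True)"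
    using assms prior(1)[of Issue2] by (simp add: payoff_active[OF both_active])
  then have "R Issue2 True \<noteq> 1" using prior(1)[of Issue1] by auto
  then have R2: "R Issue2 True < 1" using R_bounds(2)[of Issue2 True] by simp
  then have "\<pi> Issue2 < \<Lambda> Issue2"
    using B_cases[OF both_active, of Issue2] prior(1)[of Issue2] by auto
  then show ?thesis using rent_iff[OF noisy_all R2] p by simp
qed

lemma cheap_payoffs:
  assumes cheap_lobbying
  shows "ex_ante_payoff \<pi> f \<alpha> \<tau> (GI Issue1) \<le> \<pi> Issue1 * (1 - f Issue1)"
    "ex_ante_payoff \<pi> f \<alpha> \<tau> (GI Issue2) \<le> \<pi> Issue2 * (1 - \<pi> Issue1 - f Issue2)"
    "ex_ante_payoff \<pi> f \<alpha> \<tau> DP < \<alpha> + 1 - \<pi> Issue1 * \<pi> Issue2"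
proof -
  obtain k where "\<Lambda> k \<noteq> \<pi> k" using truthful_cost cheap_lobbying_cost[OF assms] by force
  then have k: "\<pi> k < \<Lambda> k" using \<Lambda>_ge[OF both_active, of k] by simp
  note noisy = noisy_all[OF k]
  note R2 = R_Issue2_less_1[OF noisy cheap_lobbying_cost[OF assms]]
  show "ex_ante_payoff \<pi> f \<alpha> \<tau> (GI Issue1) \<le> \<pi> Issue1 * (1 - f Issue1)"
    by (simp add: payoff_active[OF both_active] R_Issue1[OF noisy])
  show "ex_ante_payoff \<pi> f \<alpha> \<tau> (GI Issue2) \<le> \<pi> Issue2 * (1 - \<pi> Issue1 - f Issue2)"
    using rent_iff[OF noisy R2] assms prior(1)[of Issue2] by (simp add: payoff_active[OF both_active])
  show "ex_ante_payoff \<pi> f \<alpha> \<tau> DP < \<alpha> + 1 - \<pi> Issue1 * \<pi> Issue2"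
    by (rule DP_noisy[OF noisy R2])
qed

end

end

section \<open>Existence with two reforms\<close>

text \<open>
  The parameter \<open>\<Lambda> i\<close> is the total probability that group \<open>i\<close> lobbies; since high types always do,
  it determines the low type's mixture.
\<close>

definition active_assessment ::
  "(issue \<Rightarrow> real) \<Rightarrow> (issue \<Rightarrow> real) \<Rightarrow> (issue \<Rightarrow> real) \<Rightarrow> (issue \<Rightarrow> real) \<Rightarrow> assessment" where
  "active_assessment \<pi> \<Lambda> r g = \<lparr>
     lobby = (\<lambda>i t. if t then 1 else (\<Lambda> i - \<pi> i) / (1 - \<pi> i)),
     access = g,
     policy = (\<lambda>L s i. case own_signal s i of Some t \<Rightarrow> of_bool t | None \<Rightarrow> if L i then r i else 0),
     belief = (\<lambda>i l. if l then \<pi> i / \<Lambda> i else 0)\<rparr>"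

context lobbying
begin

text \<open>The necessary conditions found above are also sufficient:
  \<open>\<Lambda> i \<le> 2 * \<pi> i\<close> keeps the belief after lobbying at 1/2 or more, and
  \<open>r i\<close> is free only where that belief is exactly 1/2.\<close>

lemma active_equilibrium:
  fixes \<Lambda> r g :: "issue \<Rightarrow> real"
  defines "\<tau> \<equiv> active_assessment \<pi> \<Lambda> r g"
  assumes \<Lambda>: "\<And>i. \<pi> i \<le> \<Lambda> i" "\<And>i. \<Lambda> i \<le> 2 * \<pi> i"
    and r: "\<And>i. 0 \<le> r i" "\<And>i. r i \<le> 1" "\<And>i. \<Lambda> i < 2 * \<pi> i \<Longrightarrow> r i = 1"
    and g: "\<And>i. 0 \<le> g i" "g Issue1 + g Issue2 = 1"
    and low: "\<And>i. \<Lambda> (other i) * g (other i) * r i \<le> f i"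
      "\<And>i. \<pi> i < \<Lambda> i \<Longrightarrow> \<Lambda> (other i) * g (other i) * r i = f i"
    and acc: "\<And>i. 0 < g i \<Longrightarrow>
      weight \<alpha> (other i) * (1 - \<pi> (other i) / \<Lambda> (other i)) \<le> weight \<alpha> i * (1 - \<pi> i / \<Lambda> i)"
  shows "equilibrium \<pi> f \<alpha> 2 \<tau>"
proof -
  let ?R = "\<lambda>i l. if l then r i else 0"
  have \<tau>: "lobby \<tau> i True = 1" "lobby \<tau> i False = (\<Lambda> i - \<pi> i) / (1 - \<pi> i)" "access \<tau> = g"
    "policy \<tau> L s i = (case own_signal s i of Some t \<Rightarrow> of_bool t | None \<Rightarrow> ?R i (L i))"
    "belief \<tau> i l = (if l then \<pi> i / \<Lambda> i else 0)" for i L s l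
    by (simp_all add: \<tau>_def active_assessment_def)
  have \<Lambda>_bounds: "0 < \<Lambda> i" "\<Lambda> i < 1" for i
    using \<Lambda>[of i] prior[of i] by linarith+
  have g_le: "g i \<le> 1" for i using g(1)[of "other i"] g(2) by (cases i) simp_all
  have form: "policy_form \<tau> ?R" by (simp add: policy_form_def \<tau>(4))
  have lp: "lobby_prob \<pi> \<tau> i True = \<Lambda> i" for i
    using prior(2)[of i] by (simp add: lobby_prob_eq \<tau>)
  define c where "c = crowded_out \<pi> \<tau>"
  have c: "c i = \<Lambda> (other i) * g (other i)" for i by (simp add: c_def crowded_out_def lp \<tau>)
  have c1: "c i < 1" for i
    using mult_left_le[OF g_le[of "other i"], of "\<Lambda> (other i)"] \<Lambda>_bounds[of "other i"]
    unfolding c by linarith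
  have lobby_value:
    "lobby_value \<pi> f \<alpha> \<tau> i t True = (1 - c i) * of_bool t + c i * r i - f i"
    "lobby_value \<pi> f \<alpha> \<tau> i t False = 0" for i t
    using lobby_value_form[OF form, of \<pi> f \<alpha> i t] g(2) by (simp_all add: c_def \<tau>(3))
  have lobby: "lobby \<tau> i t \<in> {0..1}" for i t
    using \<Lambda>[of i] \<Lambda>_bounds[of i] prior[of i] by (cases t) (simp_all add: \<tau>)
  have acc01: "access \<tau> i \<in> {0..1}" for i using g(1) g_le by (simp add: \<tau>)
  have acc_sum: "access \<tau> Issue1 + access \<tau> Issue2 = 1" by (simp add: \<tau> g)
  have pol01: "policy \<tau> L s i \<in> {0..1}" for L s i
    using r[of i] by (simp add: \<tau> split: option.split)
  have "valid_strategies 2 \<tau>"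
    unfolding valid_strategies_def issuewise_policy_def feasible_two_iff
    using lobby acc01 acc_sum pol01 by (simp add: \<tau>(4))
  moreover have "bayes_consistent \<pi> \<tau>"
    unfolding bayes_consistent_def
    using \<Lambda>_bounds \<Lambda> prior(1) by (auto simp: all_bool_eq \<tau> lp less_imp_le)
  moreover have "lobby_rational \<pi> f \<alpha> \<tau>"
    unfolding lobby_rational_iff[OF lobby] lobby_value
  proof (intro allI)
    fix i t
    \<comment> \<open>The high type's gain from lobbying is \<open>1 - f i\<close> if
      \<open>r i = 1\<close>; otherwise the low type is indifferent and the gain is
      \<open>1 - c i\<close>.\<close>
    have "0 \<le> 1 - c i + c i * r i - f i"
    proof (cases "\<Lambda> i < 2 * \<pi> i")
      case True
      then show ?thesis using r(3)[of i] cost(2)[of i] by simp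
    next
      case False
      then show ?thesis using low(2)[of i] prior(1)[of i] c1[of i] by (simp add: c)
    qed
    moreover have "0 \<le> c i * r i - f i" if "0 < lobby \<tau> i False"
    proof -
      have "\<pi> i < \<Lambda> i" using that prior(2)[of i] by (simp add: \<tau> zero_less_divide_iff)
      then show ?thesis using low(2) by (simp add: c)
    qed
    ultimately show "(0 < lobby \<tau> i t \<longrightarrow> 0 \<le> (1 - c i) * of_bool t + c i * r i - f i) \<and>
      (lobby \<tau> i t < 1 \<longrightarrow> (1 - c i) * of_bool t + c i * r i - f i \<le> 0)"
      using low(1)[of i] by (cases t) (simp_all add: \<tau>(1) c)
  qed
  moreover have "access_rational \<alpha> \<tau>"
  proof -
    have half: "\<pi> i / \<Lambda> i = 1/2" if "\<not> \<Lambda> i < 2 * \<pi> i" for i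
    proof -
      have "\<Lambda> i = 2 * \<pi> i" using that \<Lambda>(2)[of i] by simp
      then show ?thesis using prior(1)[of i] by simp
    qed
    have "(2 * (\<pi> i / \<Lambda> i) - 1) * (1 - r i) = 0" for i
      using half[of i] r(3)[of i] by (cases "\<Lambda> i < 2 * \<pi> i") simp_all
    then have "correct (\<pi> i / \<Lambda> i) (r i) = \<pi> i / \<Lambda> i" for i
      by (rule correct_eq_self)
    then show ?thesis
      unfolding access_rational_iff[OF acc01 acc_sum] access_value_form[OF form]
      using acc by (simp add: \<tau> algebra_simps)
  qed
  moreover have "policy_rational 2 \<alpha> \<tau>"
  proof -
    have "(1/2 < final_belief \<tau> L s i \<longrightarrow> policy \<tau> L s i = 1) \<and>
      (final_belief \<tau> L s i < 1/2 \<longrightarrow> policy \<tau> L s i = 0)" for L s i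
    proof (cases "own_signal s i")
      case None
      have "\<not> \<pi> i / \<Lambda> i < 1/2" "1/2 < \<pi> i / \<Lambda> i \<Longrightarrow> \<Lambda> i < 2 * \<pi> i"
        using \<Lambda>_bounds(1)[of i] \<Lambda>(2)[of i] by (simp_all add: field_simps)
      then show ?thesis using None r(3)[of i] by (simp add: \<tau> final_belief_def)
    qed (simp add: \<tau> final_belief_def of_bool_def)
    then show ?thesis
      unfolding policy_rational_def
      using best_response_two_iff[OF alpha, of "policy \<tau> L s" "final_belief \<tau> L s" for L s, OF pol01]
      by blast
  qed
  ultimately show ?thesis by (simp add: equilibrium_def)
qed

text \<open>If the bound of \<open>truthful_cost\<close> holds, some split of access deters both low
  types; otherwise the noisy equilibrium is built. That both high types lobby is recorded for the
  final comparison.\<close>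

lemma two_reforms_equilibrium_exists:
  obtains (exists) \<tau> where "equilibrium \<pi> f \<alpha> 2 \<tau>" "\<And>i. lobby \<tau> i True = 1"
proof -
  have *: thesis if "equilibrium \<pi> f \<alpha> 2 (active_assessment \<pi> \<Lambda> r g)" for \<Lambda> r g
    using that by (rule exists) (simp add: active_assessment_def)
  have split: "P i" if "P Issue1" "P Issue2" for P and i :: issue using that by (cases i) auto
  show thesis
  proof (cases "\<pi> Issue1 * \<pi> Issue2 \<le> \<pi> Issue1 * f Issue1 + \<pi> Issue2 * f Issue2")
    case True
    \<comment> \<open>Group 1 gets access as often as is compatible with deterring group 2's low
      type.\<close>
    define q where "q = min 1 (f Issue2 / \<pi> Issue1)"
    have q: "0 \<le> q" "q \<le> 1" "\<pi> Issue1 * q \<le> f Issue2"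
      using prior(1)[of Issue1] cost(1)[of Issue2] by (auto simp: q_def field_simps min_def)
    have q2: "\<pi> Issue2 * (1 - q) \<le> f Issue1"
    proof (cases "q = 1")
      case False
      then have "\<pi> Issue1 * q = f Issue2" using prior(1)[of Issue1] by (auto simp: q_def min_def)
      then have "\<pi> Issue1 * (\<pi> Issue2 * (1 - q)) = \<pi> Issue1 * \<pi> Issue2 - \<pi> Issue2 * f Issue2"
        by (simp add: algebra_simps)
      also have "\<dots> \<le> \<pi> Issue1 * f Issue1" using True by simp
      finally show ?thesis using prior(1)[of Issue1] by simp
    qed (use cost(1)[of Issue1] in simp)
    have pi0: "\<pi> i \<noteq> 0" for i using prior(1)[of i] by simp
    show ?thesis
      by (rule *, rule active_equilibrium[where \<Lambda> = \<pi> and r = "\<lambda>_. 1" and g = "pair_fun Issue1 q (1 - q)"])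
        (use q q2 prior(1) pi0 in \<open>auto simp: less_imp_le intro: split\<close>)
  next
    case False
    \<comment> \<open>\<open>l\<close> makes the decision maker indifferent about access when \<open>B\<^sub>2 = 1/2\<close>; \<open>q\<close>, the probability
      that group 2 gets access, makes the low type of group 1 indifferent.\<close>
    define l where "l = 2 * \<alpha> * \<pi> Issue1 / (2 * \<alpha> - 1)"
    define q where "q = f Issue1 / (2 * \<pi> Issue2)"
    have l: "\<pi> Issue1 < l" "l < 2 * \<pi> Issue1" "\<alpha> * (1 - \<pi> Issue1 / l) = 1/2"
      using alpha prior(1)[of Issue1] by (simp_all add: l_def field_simps)
    have q: "2 * \<pi> Issue2 * q = f Issue1" "0 < q"
      using prior(1)[of Issue2] cost(1)[of Issue1] by (simp_all add: q_def)
    have "\<pi> Issue2 * (\<pi> Issue1 * (1 - q)) = \<pi> Issue1 * \<pi> Issue2 - \<pi> Issue1 * f Issue1 / 2"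
      by (simp add: algebra_simps flip: q(1))
    moreover have "0 < \<pi> Issue1 * f Issue1" using prior(1) cost(1) by simp
    ultimately have "\<pi> Issue2 * f Issue2 < \<pi> Issue2 * (\<pi> Issue1 * (1 - q))" using False by linarith
    then have f2: "f Issue2 < \<pi> Issue1 * (1 - q)" using prior(1)[of Issue2] by simp
    then have "0 < \<pi> Issue1 * (1 - q)" using cost(1)[of Issue2] by linarith
    then have q1: "q < 1" using prior(1)[of Issue1] by (simp add: zero_less_mult_iff)
    then have "\<pi> Issue1 * (1 - q) < l * (1 - q)" using l(1) by (intro mult_strict_right_mono) simp_all
    then have lq: "f Issue2 \<le> l * (1 - q)" "0 < l * (1 - q)"
      using f2 cost(1)[of Issue2] by linarith+
    \<comment> \<open>The reform probability for issue 2 makes its low type indifferent;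
      \<open>lq\<close> ensures that it is at most 1.\<close>
    let ?\<Lambda> = "pair_fun Issue1 l (2 * \<pi> Issue2)" and ?g = "pair_fun Issue1 (1 - q) q"
      and ?r = "pair_fun Issue1 1 (f Issue2 / (l * (1 - q)))"
    show ?thesis
    proof (rule *, rule active_equilibrium[of ?\<Lambda> ?r ?g])
      fix i
      show "\<pi> i \<le> ?\<Lambda> i" "?\<Lambda> i \<le> 2 * \<pi> i" "0 \<le> ?r i" "?r i \<le> 1" "0 \<le> ?g i"
        "?\<Lambda> i < 2 * \<pi> i \<Longrightarrow> ?r i = 1"
        using l q q1 lq prior(1)[of i] cost(1)[of i] by (cases i; simp)+
      have "?\<Lambda> (other i) * ?g (other i) * ?r i = f i"
        using q(1) lq(2) by (cases i) auto
      then show "?\<Lambda> (other i) * ?g (other i) * ?r i \<le> f i"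
        "?\<Lambda> (other i) * ?g (other i) * ?r i = f i" by simp_all
      have "weight \<alpha> i * (1 - \<pi> i / ?\<Lambda> i) = 1/2" for i
        using l(3) prior(1)[of i] by (cases i) (simp_all add: weight_def)
      from this[of i] this[of "other i"]
      show "weight \<alpha> (other i) * (1 - \<pi> (other i) / ?\<Lambda> (other i))
        \<le> weight \<alpha> i * (1 - \<pi> i / ?\<Lambda> i)" by linarith
    qed (use lq in simp)
  qed
qed
end

section \<open>Equilibria with one reform\<close>

text \<open>With one reform the decision on an issue can react to what is revealed about the other,
  so \<open>policy_form\<close> need not hold and the payoffs are kept in terms of
  \<open>policy\<close>.\<close>

lemma lobby_value_eq:
  assumes a: "access \<sigma> Issue1 + access \<sigma> Issue2 = 1"
  shows "lobby_value \<pi> f \<alpha> \<sigma> i t True =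
     (\<Sum>t'\<in>UNIV. bern (\<pi> (other i)) t' *
       (lobby \<sigma> (other i) t' *
          (access \<sigma> i * policy \<sigma> (\<lambda>_. True) (Some (i, t)) i
            + access \<sigma> (other i) * policy \<sigma> (\<lambda>_. True) (Some (other i, t')) i)
        + (1 - lobby \<sigma> (other i) t') * policy \<sigma> (pair_fun i True False) (Some (i, t)) i)) - f i"
    and "lobby_value \<pi> f \<alpha> \<sigma> i t False =
     (\<Sum>t'\<in>UNIV. bern (\<pi> (other i)) t' *
       (lobby \<sigma> (other i) t' * policy \<sigma> (pair_fun i False True) (Some (other i, t')) i
        + (1 - lobby \<sigma> (other i) t') * policy \<sigma> (\<lambda>_. False) None i))"
  unfolding lobby_value_pair_fun sum_bool continuation_payoff_eq[of _ _ _ _ _ _ i] access_other[OF a, of i]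
  by (simp_all add: Let_def algebra_simps)

section \<open>Optimal policy under the one-reform constraint\<close>

locale one_reform = lobbying +
  fixes \<sigma> :: assessment
  assumes eq: "equilibrium \<pi> f \<alpha> 1 \<sigma>"
begin

text \<open>The marginal value of reforming an issue; with one reform the issues compete through
  these numbers.\<close>

definition gain :: "profile \<Rightarrow> signal \<Rightarrow> issue \<Rightarrow> real" where
  "gain L s i = weight \<alpha> i * (2 * final_belief \<sigma> L s i - 1)"

lemma dp_value_gain:
  "dp_value \<alpha> (final_belief \<sigma> L s) r =
     (weight \<alpha> i * (1 - final_belief \<sigma> L s i)
       + weight \<alpha> (other i) * (1 - final_belief \<sigma> L s (other i)))
     + gain L s i * r i + gain L s (other i) * r (other i)"
  unfolding dp_value_eq[of _ _ _ i] correct_def gain_def by (simp add: algebra_simps)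

context
  fixes L s assumes info: "info_set L s"
begin

lemma policy_bounds:
  "0 \<le> policy \<sigma> L s i" "policy \<sigma> L s i \<le> 1" "policy \<sigma> L s i + policy \<sigma> L s (other i) \<le> 1"
  using equilibrium_policy(1)[OF eq info] by (cases i; auto simp: feasible_policy_def)+

lemma policy_optimal:
  assumes "0 \<le> a" "0 \<le> b" "a + b \<le> 1"
  shows "gain L s i * a + gain L s (other i) * b
    \<le> gain L s i * policy \<sigma> L s i + gain L s (other i) * policy \<sigma> L s (other i)"
proof -
  have "feasible_policy 1 (pair_fun i a b)"
    using assms unfolding feasible_policy_def all_issue[of _ i] by (cases i) simp_all
  from equilibrium_policy(2)[OF eq info this] show ?thesis
    unfolding dp_value_gain[of _ _ _ i] by simp
qed

lemma policy_harmful: "gain L s i < 0 \<Longrightarrow> policy \<sigma> L s i = 0"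
  using policy_optimal[of 0 "policy \<sigma> L s (other i)" i] policy_bounds[of i] policy_bounds[of "other i"]
  by (simp add: zero_le_mult_iff)

lemma policy_best:
  assumes "0 < gain L s i" "gain L s (other i) < gain L s i"
  shows "policy \<sigma> L s i = 1" "policy \<sigma> L s (other i) = 0"
proof -
  let ?p = "policy \<sigma> L s"
  \<comment> \<open>Probability not spent on reforming issue \<open>i\<close> earns at most
    \<open>m\<close>.\<close>
  define m where "m = max 0 (gain L s (other i))"
  have m: "m < gain L s i" "0 \<le> m" "gain L s (other i) \<le> m" using assms by (auto simp: m_def)
  have "gain L s (other i) * ?p (other i) \<le> m * ?p (other i)"
    using m(3) policy_bounds(1) by (rule mult_right_mono)
  also have "\<dots> \<le> m * (1 - ?p i)" using policy_bounds(3)[of i] m(2) by (intro mult_left_mono) auto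
  finally have "(gain L s i - m) * (1 - ?p i) \<le> 0"
    using policy_optimal[of 1 0 i] by (simp add: algebra_simps)
  then have "1 \<le> ?p i" using m(1) by (simp add: mult_le_0_iff)
  then show "?p i = 1" "?p (other i) = 0"
    using policy_bounds[of i] policy_bounds(1)[of "other i"] by auto
qed

end

lemma final_belief_bounds: "0 \<le> final_belief \<sigma> L s i" "final_belief \<sigma> L s i \<le> 1"
  using equilibrium_belief(1,2)[OF eq] by (auto simp: final_belief_def split: option.split)

lemma policy_pessimistic:
  "info_set L s \<Longrightarrow> final_belief \<sigma> L s i < 1/2 \<Longrightarrow> policy \<sigma> L s i = 0"
  using policy_harmful[of L s i] weight_pos[OF alpha, of i] by (simp add: gain_def mult_less_0_iff)

lemma policy_refuted: "L i \<Longrightarrow> policy \<sigma> L (Some (i, False)) i = 0"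
  by (rule policy_pessimistic) (simp_all add: final_belief_def)

lemma policy_Issue1_certain:
  assumes "info_set L s" "final_belief \<sigma> L s Issue1 = 1"
  shows "policy \<sigma> L s Issue1 = 1" "policy \<sigma> L s Issue2 = 0"
proof -
  have "0 < gain L s Issue1" "gain L s Issue2 < gain L s Issue1"
    using assms(2) alpha final_belief_bounds(2)[of L s Issue2] by (simp_all add: gain_def weight_def)
  then show "policy \<sigma> L s Issue1 = 1" "policy \<sigma> L s Issue2 = 0"
    using policy_best[OF assms(1), of Issue1] by simp_all
qed

lemma policy_Issue2_only:
  assumes "info_set L s" "final_belief \<sigma> L s Issue1 < 1/2" "final_belief \<sigma> L s Issue2 = 1"
  shows "policy \<sigma> L s Issue2 = 1"
proof -
  have "gain L s Issue1 < 0" "gain L s Issue2 = 1"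
    using assms(2,3) alpha by (simp_all add: gain_def weight_def mult_less_0_iff)
  then show ?thesis using policy_best[OF assms(1), of Issue2] by simp
qed

section \<open>Access and truthful lobbying with one reform\<close>

abbreviation x where "x i \<equiv> lobby \<sigma> i True"
abbreviation y where "y i \<equiv> lobby \<sigma> i False"
abbreviation B where "B i \<equiv> belief \<sigma> i True"
abbreviation g where "g i \<equiv> access \<sigma> i"

lemmas g_sum = equilibrium_access(3)[OF eq]
lemmas value_eq = lobby_value_eq[OF g_sum]
lemmas x_bounds = equilibrium_lobby(1,2)[OF eq, of _ True]
lemmas y_bounds = equilibrium_lobby(1,2)[OF eq, of _ False]
lemmas B_bounds = equilibrium_belief(1,2)[OF eq, of _ True]

lemma silence_value_nonneg: "0 \<le> lobby_value \<pi> f \<alpha> \<sigma> i t False"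
  unfolding value_eq sum_bool
  using prior[of "other i"] x_bounds[of "other i"] y_bounds[of "other i"]
  by (intro add_nonneg_nonneg mult_nonneg_nonneg policy_bounds(1)) auto

text \<open>The value of access to group 1 is bounded below by trial policies, that of access to
  group 2 above by relaxing its optimal policies. The gap between the bounds is checked by cases on
  which reform is worth more and on \<open>d\<close>.\<close>

lemma access_Issue1_better:
  assumes "1/2 \<le> B Issue1" "B Issue1 < 1"
  shows "access_value \<alpha> \<sigma> Issue2 < access_value \<alpha> \<sigma> Issue1"
proof -
  define b d where "b = B Issue1" and "d = B Issue2"
  let ?V = "\<lambda>i t. dp_value \<alpha> (final_belief \<sigma> (\<lambda>_. True) (Some (i, t)))
    (policy \<sigma> (\<lambda>_. True) (Some (i, t)))"
  have b: "1/2 \<le> b" "b < 1" and d: "0 \<le> d" "d \<le> 1" using assms B_bounds[of Issue2] by (auto simp: b_def d_def)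
  have dp: "dp_value \<alpha> (final_belief \<sigma> (\<lambda>_. True) (Some (Issue1, t))) r =
      \<alpha> * (if t then r Issue1 else 1 - r Issue1) + (1 - d + (2 * d - 1) * r Issue2)"
    "dp_value \<alpha> (final_belief \<sigma> (\<lambda>_. True) (Some (Issue2, t))) r =
      \<alpha> * (1 - b + (2 * b - 1) * r Issue1) + (if t then r Issue2 else 1 - r Issue2)" for t r
    using own_signal_simps(3,4)[of Issue1] own_signal_simps(3,4)[of Issue2]
    by (simp_all add: dp_value_eq[of _ _ _ Issue1] weight_def correct_def final_belief_def b_def d_def
        split: option.split)
  have V1_ge: "dp_value \<alpha> (final_belief \<sigma> (\<lambda>_. True) (Some (Issue1, t))) r \<le> ?V Issue1 t"
    if "feasible_policy 1 r" for t r
    using equilibrium_policy(2)[OF eq _ that] by simp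
  have feas: "feasible_policy 1 (pair_fun Issue1 p q)" if "0 \<le> p" "0 \<le> q" "p + q \<le> 1" for p q
    using that unfolding feasible_policy_def all_issue[of _ Issue1] by simp
  \<comment> \<open>The trial policies reform issue 1 in state 1, and in state 0 either nothing or
    issue 2.\<close>
  have V1: "\<alpha> + (1 - d) \<le> ?V Issue1 True" "\<alpha> + (1 - d) \<le> ?V Issue1 False" "\<alpha> + d \<le> ?V Issue1 False"
    using V1_ge[OF feas[of 1 0], of True] V1_ge[OF feas[of 0 0], of False]
      V1_ge[OF feas[of 0 1], of False] by (simp_all add: dp(1))
  have V_eq: "access_value \<alpha> \<sigma> Issue1 = b * ?V Issue1 True + (1 - b) * ?V Issue1 False"
    "access_value \<alpha> \<sigma> Issue2 = d * ?V Issue2 True + (1 - d) * ?V Issue2 False"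
    by (simp_all add: access_value_def sum_bool b_def d_def)
  \<comment> \<open>The larger gain available from one reform once the state of issue 2 is revealed
    to be 1.\<close>
  define m where "m = max (\<alpha> * (2 * b - 1)) 1"
  have p: "0 \<le> policy \<sigma> (\<lambda>_. True) (Some (Issue2, t)) Issue1"
    "policy \<sigma> (\<lambda>_. True) (Some (Issue2, t)) Issue1 \<le> 1"
    "0 \<le> policy \<sigma> (\<lambda>_. True) (Some (Issue2, t)) Issue2"
    "policy \<sigma> (\<lambda>_. True) (Some (Issue2, t)) Issue1 + policy \<sigma> (\<lambda>_. True) (Some (Issue2, t)) Issue2 \<le> 1" for t
    using policy_bounds[of "\<lambda>_. True" "Some (Issue2, t)" Issue1] policy_bounds[of "\<lambda>_. True" "Some (Issue2, t)" Issue2]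
    by simp_all
  have V2T: "?V Issue2 True \<le> \<alpha> * (1 - b) + m"
  proof -
    let ?p = "policy \<sigma> (\<lambda>_. True) (Some (Issue2, True))"
    have "\<alpha> * (2 * b - 1) * ?p Issue1 + 1 * ?p Issue2 \<le> m * ?p Issue1 + m * ?p Issue2"
      using p[of True] by (intro add_mono mult_right_mono) (auto simp: m_def)
    also have "\<dots> = m * (?p Issue1 + ?p Issue2)" by (simp add: algebra_simps)
    also have "\<dots> \<le> m" using p(4)[of True] by (intro mult_left_le) (auto simp: m_def)
    finally show ?thesis by (simp add: dp(2) algebra_simps)
  qed
  have V2F: "?V Issue2 False \<le> \<alpha> * b + 1"
  proof -
    let ?p = "policy \<sigma> (\<lambda>_. True) (Some (Issue2, False))"
    have "(2 * b - 1) * ?p Issue1 \<le> (2 * b - 1) * 1" using b p[of False] by (intro mult_left_mono) auto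
    then have "\<alpha> * (1 - b + (2 * b - 1) * ?p Issue1) \<le> \<alpha> * b" using alpha by simp
    then show ?thesis using p(3)[of False] by (simp add: dp(2))
  qed
  have V2: "access_value \<alpha> \<sigma> Issue2 \<le> d * (\<alpha> * (1 - b) + m) + (1 - d) * (\<alpha> * b + 1)"
    unfolding V_eq using V2T V2F d by (intro add_mono mult_left_mono) auto
  have V1a: "b * (\<alpha> + (1 - d)) + (1 - b) * (\<alpha> + (1 - d)) \<le> access_value \<alpha> \<sigma> Issue1"
    "b * (\<alpha> + (1 - d)) + (1 - b) * (\<alpha> + d) \<le> access_value \<alpha> \<sigma> Issue1"
    unfolding V_eq using V1 b by (auto intro!: add_mono mult_left_mono)
  show ?thesis
  proof (cases "\<alpha> * (2 * b - 1) \<le> 1")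
    case True
    then have m: "m = 1" by (simp add: m_def)
    define e where "e = 1 - \<alpha> * (2 * b - 1)"
    have e: "0 \<le> e" using True by (simp add: e_def)
    show ?thesis
    proof (cases "d \<le> 1/2")
      case True
      have "d * e \<le> 1/2 * e" using True e by (rule mult_right_mono)
      also have "\<dots> < \<alpha> * (1 - b)" using alpha by (simp add: e_def algebra_simps)
      finally have "0 < \<alpha> * (1 - b) - d * e" by simp
      also have "\<dots> = b * (\<alpha> + (1 - d)) + (1 - b) * (\<alpha> + (1 - d))
          - (d * (\<alpha> * (1 - b) + m) + (1 - d) * (\<alpha> * b + 1))"
        by (simp add: e_def m algebra_simps)
      finally show ?thesis using V1a(1) V2 by linarith
    next
      case False
      \<comment> \<open>The bound is affine in \<open>d\<close>; this interpolates its values at \<open>d = 1/2\<close> and \<open>d = 1\<close>.\<close>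
      have "(\<alpha> - 1) * b * (2 * d - 1) + (\<alpha> - 1) * (1 - d) > 0"
        using False alpha b d by (intro add_pos_nonneg) simp_all
      also have "(\<alpha> - 1) * b * (2 * d - 1) + (\<alpha> - 1) * (1 - d) = b * (\<alpha> + (1 - d)) + (1 - b) * (\<alpha> + d)
          - (d * (\<alpha> * (1 - b) + m) + (1 - d) * (\<alpha> * b + 1))"
        by (simp add: m algebra_simps)
      finally show ?thesis using V1a(2) V2 by linarith
    qed
  next
    case False
    then have m: "m = \<alpha> * (2 * b - 1)" by (simp add: m_def)
    have "0 < \<alpha> * (1 - b)" using alpha b by simp
    also have "\<dots> = b * (\<alpha> + (1 - d)) + (1 - b) * (\<alpha> + (1 - d))
        - (d * (\<alpha> * (1 - b) + m) + (1 - d) * (\<alpha> * b + 1))"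
      by (simp add: m algebra_simps)
    finally show ?thesis using V1a(1) V2 by linarith
  qed
qed

text \<open>A lobbying low type must hope that group 2 gets access and issue 1 is still reformed, so
  \<open>B Issue1\<close> is at least 1/2. Its own lobbying keeps \<open>B Issue1\<close> below 1,
  and then access to group 2 is not optimal.\<close>

lemma y_Issue1: "y Issue1 = 0"
proof (rule ccontr)
  assume "y Issue1 \<noteq> 0"
  then have y: "0 < y Issue1" using y_bounds(1)[of Issue1] by simp
  then have "0 \<le> lobby_value \<pi> f \<alpha> \<sigma> Issue1 False True"
    using equilibrium_lobby(3)[OF eq] silence_value_nonneg order_trans by blast
  then have v: "f Issue1 \<le> \<pi> Issue2 * (x Issue2 * (g Issue2 * policy \<sigma> (\<lambda>_. True) (Some (Issue2, True)) Issue1))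
    + (1 - \<pi> Issue2) * (y Issue2 * (g Issue2 * policy \<sigma> (\<lambda>_. True) (Some (Issue2, False)) Issue1))"
    by (simp add: value_eq sum_bool policy_refuted)
  have "0 < g Issue2"
    using v cost(1)[of Issue1] equilibrium_access(1)[OF eq, of Issue2] by (cases "g Issue2 = 0") auto
  then have "access_value \<alpha> \<sigma> Issue1 \<le> access_value \<alpha> \<sigma> Issue2"
    using equilibrium_access(4)[OF eq, of Issue2] by simp
  moreover have "1/2 \<le> B Issue1"
  proof (rule ccontr)
    assume "\<not> 1/2 \<le> B Issue1"
    then have "policy \<sigma> (\<lambda>_. True) (Some (Issue2, t)) Issue1 = 0" for t
      using own_signal_simps(3,4)[of Issue1]
      by (intro policy_pessimistic) (simp_all add: final_belief_def)
    then show False using v cost(1)[of Issue1] by simp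
  qed
  moreover have "B Issue1 < 1"
  proof -
    let ?l = "lobby_prob \<pi> \<sigma> Issue1 True"
    have "0 < (1 - \<pi> Issue1) * y Issue1" using y prior(2)[of Issue1] by simp
    then have l: "\<pi> Issue1 * x Issue1 < ?l" by (simp add: lobby_prob_eq)
    moreover have "0 \<le> \<pi> Issue1 * x Issue1" using prior(1)[of Issue1] x_bounds(1)[of Issue1] by simp
    ultimately have "B Issue1 * ?l < 1 * ?l"
      using equilibrium_belief(3)[OF eq, of Issue1 True] by simp
    then show ?thesis using l \<open>0 \<le> \<pi> Issue1 * x Issue1\<close> by (simp add: mult_less_cancel_right)
  qed
  ultimately show False using access_Issue1_better by simp
qed

lemma lobby_prob_truthful:
  assumes "y i = 0"
  shows "lobby_prob \<pi> \<sigma> i True < 1"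
  using assms prior[of i] mult_left_le[OF x_bounds(2)[of i], of "\<pi> i"]
  unfolding lobby_prob_eq assms mult_zero_right add_0_right by linarith

lemma silence_pessimistic:
  assumes "y i = 0" "info_set L s" "\<not> L i" "own_signal s i = None"
  shows "final_belief \<sigma> L s i < 1/2" "policy \<sigma> L s i = 0"
proof -
  show "final_belief \<sigma> L s i < 1/2"
    using silence_belief_less_half[OF eq _ lobby_prob_truthful] assms by (simp add: final_belief_def)
  then show "policy \<sigma> L s i = 0" using policy_pessimistic assms(2) by simp
qed

lemma silence_Issue1_value: "lobby_value \<pi> f \<alpha> \<sigma> Issue1 t False = 0"
  using silence_pessimistic(2)[OF y_Issue1] own_signal_simps(4)[of Issue1]
  by (simp add: value_eq sum_bool)

lemma both_lobby_certain:
  assumes "B Issue1 = 1"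
  shows "policy \<sigma> (\<lambda>_. True) (Some (Issue2, t)) Issue1 = 1"
    "policy \<sigma> (\<lambda>_. True) (Some (Issue2, t)) Issue2 = 0"
  using policy_Issue1_certain[of "\<lambda>_. True" "Some (Issue2, t)"] own_signal_simps(4)[of Issue1] assms
  by (simp_all add: final_belief_def)

lemma revealed_Issue1:
  assumes "L Issue1"
  shows "policy \<sigma> L (Some (Issue1, True)) Issue1 = 1" "policy \<sigma> L (Some (Issue1, True)) Issue2 = 0"
  using policy_Issue1_certain[of L "Some (Issue1, True)"] assms by (simp_all add: final_belief_def)

lemma x_pos_Issue1_value:
  assumes "0 < x Issue1"
  shows "lobby_value \<pi> f \<alpha> \<sigma> Issue1 True True = 1 - f Issue1"
  using both_lobby_certain(1)[OF truthful_belief[OF eq y_Issue1 assms]] g_sum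
  by (simp add: value_eq sum_bool revealed_Issue1)

text \<open>If the high type lobbies at all, it is believed and gets its reform whoever has access;
  \<open>1 - f Issue1 > 0\<close> then excludes mixing.\<close>

lemma x_Issue1: "x Issue1 = 0 \<or> x Issue1 = 1"
  using x_pos_Issue1_value equilibrium_lobby(4)[OF eq, of Issue1 True] silence_Issue1_value
    cost(2)[of Issue1] x_bounds[of Issue1] by fastforce

text \<open>Issue 1 takes the single reform whenever its group lobbies, so group 2 wins only in
  state 1 against a silent group 1.\<close>

lemma lobby_Issue2_value:
  "lobby_value \<pi> f \<alpha> \<sigma> Issue2 t True = (1 - \<pi> Issue1 * x Issue1) * of_bool t - f Issue2"
proof -
  have lone: "policy \<sigma> (pair_fun Issue2 True False) (Some (Issue2, t)) Issue2 = of_bool t"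
  proof (cases t)
    case True
    then show ?thesis
      using silence_pessimistic(1)[OF y_Issue1, of "pair_fun Issue2 True False" "Some (Issue2, True)"]
        own_signal_simps(4)[of Issue1]
      by (simp add: policy_Issue2_only final_belief_def)
  qed (simp add: policy_refuted)
  have "x Issue1 * policy \<sigma> (\<lambda>_. True) (Some (Issue2, t)) Issue2 = 0"
    using both_lobby_certain(2)[OF truthful_belief[OF eq y_Issue1]] x_Issue1 by auto
  then have "x Issue1 * (g Issue2 * policy \<sigma> (\<lambda>_. True) (Some (Issue2, t)) Issue2) = 0" by auto
  then show ?thesis
    by (simp add: value_eq sum_bool y_Issue1 revealed_Issue1 lone algebra_simps)
qed

lemma y_Issue2: "y Issue2 = 0"
  using equilibrium_lobby(3)[OF eq, of Issue2 False] lobby_Issue2_value[of False] cost(1)[of Issue2]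
    silence_value_nonneg[of Issue2 False] y_bounds(1)[of Issue2] by fastforce

lemma silence_Issue2_value: "lobby_value \<pi> f \<alpha> \<sigma> Issue2 t False = 0"
  using silence_pessimistic(2)[OF y_Issue2, of "\<lambda>_. False" None]
  by (simp add: value_eq sum_bool y_Issue1 revealed_Issue1)

text \<open>At equality the high type is indifferent, the source of the knife-edge case, so only
  strict comparisons determine it.\<close>

lemma x_Issue2:
  "f Issue2 < 1 - \<pi> Issue1 * x Issue1 \<Longrightarrow> x Issue2 = 1"
  "1 - \<pi> Issue1 * x Issue1 < f Issue2 \<Longrightarrow> x Issue2 = 0"
  using equilibrium_lobby(3,4)[OF eq, of Issue2 True] lobby_Issue2_value[of True]
    silence_Issue2_value[of True] x_bounds[of Issue2] by force+

lemma payoff_GI2: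
  "ex_ante_payoff \<pi> f \<alpha> \<sigma> (GI Issue2) = \<pi> Issue2 * (x Issue2 * (1 - \<pi> Issue1 * x Issue1 - f Issue2))"
  by (simp add: ex_ante_payoff_GI sum_bool lobby_Issue2_value silence_Issue2_value y_Issue2)

lemma payoff_GI1:
  "ex_ante_payoff \<pi> f \<alpha> \<sigma> (GI Issue1) = \<pi> Issue1 * (x Issue1 * (1 - f Issue1))"
  using x_Issue1 x_pos_Issue1_value
  by (auto simp: ex_ante_payoff_GI sum_bool silence_Issue1_value y_Issue1)

lemma payoff_DP:
  "ex_ante_payoff \<pi> f \<alpha> \<sigma> DP = \<alpha> * (1 - \<pi> Issue1 + \<pi> Issue1 * x Issue1)
     + (1 - \<pi> Issue2) + \<pi> Issue2 * (x Issue2 * (1 - \<pi> Issue1 * x Issue1))"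
proof -
  have lone: "policy \<sigma> (pair_fun Issue1 False True) (Some (Issue2, True)) Issue2 = 1"
      "policy \<sigma> (pair_fun Issue1 False True) (Some (Issue2, True)) Issue1 = 0"
    using silence_pessimistic[OF y_Issue1, of "pair_fun Issue1 False True" "Some (Issue2, True)"]
      own_signal_simps(4)[of Issue1]
    by (simp_all add: policy_Issue2_only final_belief_def)
  have none: "policy \<sigma> (\<lambda>_. False) None Issue1 = 0" "policy \<sigma> (\<lambda>_. False) None Issue2 = 0"
    using silence_pessimistic(2)[OF y_Issue1, of "\<lambda>_. False" None]
      silence_pessimistic(2)[OF y_Issue2, of "\<lambda>_. False" None] by simp_all
  have g2: "g Issue2 = 1 - g Issue1" using g_sum by simp
  have "x Issue1 = 1 \<Longrightarrow> B Issue1 = 1" using truthful_belief[OF eq y_Issue1] by simp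
  then show ?thesis
    unfolding ex_ante_payoff_pair_fun[of _ _ _ _ _ Issue1] sum_bool
      continuation_payoff_eq[of _ _ _ _ _ _ Issue1] payoff_DP_eq[of _ _ _ _ _ Issue1] expected_u_eq
    using x_Issue1 revealed_Issue1 both_lobby_certain
    by (auto simp: Let_def y_Issue1 y_Issue2 lone none weight_def g2 algebra_simps)
qed

text \<open>If group 1 is silent, group 2 lobbies exactly in state 1, so a deviating high type of
  group 1 succeeds at least whenever group 2 is silent.\<close>

lemma silent_Issue1_cost:
  assumes "x Issue1 = 0"
  shows "1 - \<pi> Issue2 \<le> f Issue1"
proof -
  have x2: "x Issue2 = 1" using x_Issue2(1) assms cost(2)[of Issue2] by simp
  have "lobby_value \<pi> f \<alpha> \<sigma> Issue1 True True \<le> 0"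
    using equilibrium_lobby(4)[OF eq, of Issue1 True] assms silence_Issue1_value by simp
  moreover have "0 \<le> \<pi> Issue2 * (g Issue1 + g Issue2 * policy \<sigma> (\<lambda>_. True) (Some (Issue2, True)) Issue1)"
    using prior(1)[of Issue2] equilibrium_access(1)[OF eq]
    by (intro mult_nonneg_nonneg add_nonneg_nonneg policy_bounds(1)) auto
  ultimately show ?thesis by (simp add: value_eq sum_bool x2 y_Issue2 revealed_Issue1)
qed

end

section \<open>Existence with one reform and comparison\<close>

lemma best_response_one:
  assumes "1 < \<alpha>" and b1: "b Issue1 = 0 \<or> b Issue1 = 1" and b2: "b Issue2 \<le> 1/2 \<or> b Issue2 = 1"
    and r: "feasible_policy 1 r"
  shows "dp_value \<alpha> b r
    \<le> dp_value \<alpha> b (pair_fun Issue1 (of_bool (b Issue1 = 1)) (of_bool (b Issue1 \<noteq> 1 \<and> b Issue2 = 1)))"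
proof -
  have r: "0 \<le> r Issue1" "0 \<le> r Issue2" "r Issue1 + r Issue2 \<le> 1"
    using r by (simp_all add: feasible_policy_def)
  have r2: "(2 * b Issue2 - 1) * r Issue2 \<le> of_bool (b Issue2 = 1) * r Issue2"
    using b2 r(2) by (intro mult_right_mono) auto
  show ?thesis
    using b1
  proof
    assume b: "b Issue1 = 0"
    have "0 \<le> \<alpha> * r Issue1" using assms(1) r(1) by simp
    then show ?thesis
      using r r2 b by (cases "b Issue2 = 1") (simp_all add: dp_value_eq[of _ _ _ Issue1] weight_def correct_def algebra_simps)
  next
    assume b: "b Issue1 = 1"
    have "1 * r Issue2 \<le> \<alpha> * (1 - r Issue1)"
      using assms(1) r by (intro mult_mono) auto
    moreover have "of_bool (b Issue2 = 1) * r Issue2 \<le> r Issue2" using r(2) by simp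
    ultimately show ?thesis
      using r2 b by (simp add: dp_value_eq[of _ _ _ Issue1] weight_def correct_def algebra_simps)
  qed
qed

context lobbying
begin

lemma one_reform_equilibrium_exists: "\<exists>\<sigma>. equilibrium \<pi> f \<alpha> 1 \<sigma>"
proof -
  \<comment> \<open>\<open>z\<close> says whether lobbying pays for group 2's high type. If not,
    group 2 never lobbies, its silence keeps the prior, and its off-path lobbying is
    believed.\<close>
  define z where "z \<longleftrightarrow> f Issue2 \<le> 1 - \<pi> Issue1"
  define \<beta> where "\<beta> i l = (if l then 1 else if i = Issue2 \<and> \<not> z then \<pi> i else 0)" for i l
  define fb where "fb L s i = (case own_signal s i of Some t \<Rightarrow> of_bool t | None \<Rightarrow> \<beta> i (L i))" for L s i
  define \<sigma> where "\<sigma> = \<lparr>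
    lobby = (\<lambda>i t. of_bool (t \<and> (i = Issue1 \<or> z))),
    access = pair_fun Issue1 1 0,
    policy = (\<lambda>L s. pair_fun Issue1 (of_bool (fb L s Issue1 = 1)) (of_bool (fb L s Issue1 \<noteq> 1 \<and> fb L s Issue2 = 1))),
    belief = \<beta>\<rparr>"
  have \<sigma>: "lobby \<sigma> i t = of_bool (t \<and> (i = Issue1 \<or> z))" "access \<sigma> = pair_fun Issue1 1 0"
    "policy \<sigma> L s = pair_fun Issue1 (of_bool (fb L s Issue1 = 1)) (of_bool (fb L s Issue1 \<noteq> 1 \<and> fb L s Issue2 = 1))"
    "belief \<sigma> = \<beta>" for i t L s
    by (simp_all add: \<sigma>_def)
  have fb: "final_belief \<sigma> = fb" by (auto simp: final_belief_def fb_def \<sigma> fun_eq_iff split: option.split)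
  have neq1: "\<pi> i \<noteq> 1" "\<pi> i \<noteq> 0" for i using prior[of i] by simp_all
  have lobby: "lobby \<sigma> i t \<in> {0..1}" for i t by (simp add: \<sigma>)
  have acc: "access \<sigma> i \<in> {0..1}" for i by (cases i) (simp_all add: \<sigma>)
  have acc_sum: "access \<sigma> Issue1 + access \<sigma> Issue2 = 1" by (simp add: \<sigma>)
  have sig: "own_signal (Some (Issue1, t)) Issue2 = None" "own_signal (Some (Issue2, t)) Issue1 = None" for t
    using own_signal_simps(3)[of Issue1] own_signal_simps(3)[of Issue2] by simp_all
  have "valid_strategies 1 \<sigma>"
    unfolding valid_strategies_def feasible_policy_def all_issue[of _ Issue1]
    using lobby acc by (simp add: \<sigma>)
  moreover have "bayes_consistent \<pi> \<sigma>"
    unfolding bayes_consistent_def all_issue[of _ Issue1] all_bool_eq lobby_prob_eq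
    using prior[of Issue2] neq1 by (simp add: \<sigma> \<beta>_def)
  moreover have "lobby_rational \<pi> f \<alpha> \<sigma>"
    unfolding lobby_rational_iff[OF lobby] all_issue[of _ Issue1] all_bool_eq lobby_value_eq[OF acc_sum]
    using prior cost neq1
    by (simp add: \<sigma> sum_bool fb_def \<beta>_def sig z_def less_imp_le)
  moreover have "access_rational \<alpha> \<sigma>"
    unfolding access_rational_iff[OF acc acc_sum] all_issue[of _ Issue1]
    by (simp add: \<sigma> access_value_def sum_bool fb dp_value_eq[of _ _ _ Issue1] correct_def fb_def \<beta>_def sig)
  moreover have "policy_rational 1 \<alpha> \<sigma>"
  proof -
    have "fb L s Issue1 = 0 \<or> fb L s Issue1 = 1" "fb L s Issue2 \<le> 1/2 \<or> fb L s Issue2 = 1" for L s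
      using prior(2)[of Issue2] by (auto simp: fb_def \<beta>_def split: option.split)
    then show ?thesis
      unfolding policy_rational_def \<sigma>(3) fb using best_response_one[OF alpha] by blast
  qed
  ultimately show ?thesis unfolding equilibrium_def by blast
qed

lemma pareto_improves_iff:
  "pareto_improves \<pi> f \<alpha> \<sigma> \<tau> \<longleftrightarrow>
    (let U = \<lambda>\<sigma> j. ex_ante_payoff \<pi> f \<alpha> \<sigma> j in
     U \<tau> (GI Issue1) \<le> U \<sigma> (GI Issue1) \<and> U \<tau> (GI Issue2) \<le> U \<sigma> (GI Issue2) \<and> U \<tau> DP \<le> U \<sigma> DP \<and>
     (U \<tau> (GI Issue1) < U \<sigma> (GI Issue1) \<or> U \<tau> (GI Issue2) < U \<sigma> (GI Issue2) \<or> U \<tau> DP < U \<sigma> DP))"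
proof -
  have "(\<forall>j. P j) \<longleftrightarrow> P (GI Issue1) \<and> P (GI Issue2) \<and> P DP"
    "(\<exists>j. P j) \<longleftrightarrow> P (GI Issue1) \<or> P (GI Issue2) \<or> P DP" for P
    by (metis issue.exhaust player.exhaust)+
  then show ?thesis unfolding pareto_improves_def Let_def by simp
qed

section \<open>Comparison of a given pair of equilibria\<close>

context
  fixes \<sigma> \<tau>
  assumes eq1: "equilibrium \<pi> f \<alpha> 1 \<sigma>" and eq2: "equilibrium \<pi> f \<alpha> 2 \<tau>"
begin

interpretation one: one_reform \<pi> f \<alpha> \<sigma> by unfold_locales (rule eq1)
interpretation two: two_reforms \<pi> f \<alpha> \<tau> by unfold_locales (rule eq2)

lemma cheap_improves:
  assumes cheap_lobbying
  shows "pareto_improves \<pi> f \<alpha> \<sigma> \<tau>"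
proof -
  have active: "two.x i = 1" for i
    using two.silent_cost[of i] cheap_lobbying_cost_half[OF assms, of i] by linarith
  have x1: "one.x Issue1 = 1"
    using one.x_Issue1 one.silent_Issue1_cost cheap_lobbying_cost_half[OF assms, of Issue1] by auto
  then have x2: "one.x Issue2 = 1"
    using one.x_Issue2(1) cheap_lobbying_cost_half[OF assms, of Issue2] by simp
  have "ex_ante_payoff \<pi> f \<alpha> \<sigma> DP = \<alpha> + 1 - \<pi> Issue1 * \<pi> Issue2"
    by (simp add: one.payoff_DP x1 x2 algebra_simps)
  then show ?thesis
    using two.cheap_payoffs[OF active assms]
    by (simp add: pareto_improves_iff one.payoff_GI1 one.payoff_GI2 x1 x2)
qed

text \<open>Both groups earn positive payoffs with two reforms, so an improvement requires both high
  types to lobby with one reform too. Group 2's comparison then decides.\<close>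

lemma improves_cheap_if_active:
  assumes "pareto_improves \<pi> f \<alpha> \<sigma> \<tau>" and active: "\<And>i. two.x i = 1"
  shows cheap_lobbying
proof -
  have GI: "ex_ante_payoff \<pi> f \<alpha> \<tau> (GI i) \<le> ex_ante_payoff \<pi> f \<alpha> \<sigma> (GI i)" for i
    using assms(1) by (simp add: pareto_improves_def)
  have "one.x Issue1 \<noteq> 0"
    using GI[of Issue1] two.payoff_active_pos[OF active, of Issue1] by (auto simp: one.payoff_GI1)
  then have x1: "one.x Issue1 = 1" using one.x_Issue1 by simp
  have "0 < \<pi> Issue2 * (one.x Issue2 * (1 - \<pi> Issue1 - f Issue2))"
    using GI[of Issue2] two.payoff_active_pos[OF active, of Issue2] by (simp add: one.payoff_GI2 x1)
  then have "f Issue2 < 1 - \<pi> Issue1"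
    using prior(1)[of Issue2] one.x_bounds(1)[of Issue2] by (auto simp: zero_less_mult_iff)
  then have "one.x Issue2 = 1" using one.x_Issue2(1) x1 by simp
  then show ?thesis
    using two.cheap_if_GI2_better[OF active] GI[of Issue2] by (simp add: one.payoff_GI2 x1)
qed

text \<open>If a group is silent with two reforms, an improvement forces the same group to be silent
  with one reform; all payoffs then agree and nothing is strict. For group 2 this uses that the
  knife edge is excluded.\<close>

lemma improves_cheap:
  assumes imp: "pareto_improves \<pi> f \<alpha> \<sigma> \<tau>" and f2: "f Issue2 \<noteq> 1 - \<pi> Issue1"
  shows cheap_lobbying
proof (cases "two.x Issue1 = 1")
  case False
  note pay = two.payoffs_silent[OF False]
  have x1: "one.x Issue1 = 0"
  proof (rule ccontr)
    assume "one.x Issue1 \<noteq> 0"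
    then have x1: "one.x Issue1 = 1" using one.x_Issue1 by simp
    have "one.x Issue2 * (1 - \<pi> Issue1 - f Issue2) < 1 - f Issue2"
    proof (cases "one.x Issue2 = 0")
      case False
      then have "one.x Issue2 * (1 - \<pi> Issue1 - f Issue2) < one.x Issue2 * (1 - f Issue2)"
        using one.x_bounds(1)[of Issue2] prior(1)[of Issue1] by simp
      also have "\<dots> \<le> 1 * (1 - f Issue2)"
        using one.x_bounds(2)[of Issue2] cost(2)[of Issue2] by (intro mult_right_mono) auto
      finally show ?thesis by simp
    qed (use cost(2) in simp)
    then have "\<pi> Issue2 * (one.x Issue2 * (1 - \<pi> Issue1 - f Issue2)) < \<pi> Issue2 * (1 - f Issue2)"
      using prior(1)[of Issue2] by simp
    then show False using imp pay by (simp add: pareto_improves_iff Let_def one.payoff_GI2 x1)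
  qed
  then have x2: "one.x Issue2 = 1" using one.x_Issue2(1) cost(2)[of Issue2] by simp
  show ?thesis
    using imp pay
    by (simp add: pareto_improves_iff one.payoff_GI1 one.payoff_GI2 one.payoff_DP x1 x2 weight_def Let_def)
next
  case x: True
  show ?thesis
  proof (cases "two.x Issue2 = 1")
    case False
    note pay = two.payoffs_silent[OF False]
    have "one.x Issue1 \<noteq> 0"
    proof
      assume "one.x Issue1 = 0"
      then have "\<pi> Issue1 * (1 - f Issue1) \<le> 0"
        using imp pay by (simp add: pareto_improves_iff one.payoff_GI1 Let_def)
      then show False using prior(1)[of Issue1] cost(2)[of Issue1] by (simp add: mult_le_0_iff)
    qed
    then have x1: "one.x Issue1 = 1" using one.x_Issue1 by simp
    have "1 - \<pi> Issue1 < f Issue2" using two.silent_cost[OF False] f2 by simp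
    then have x2: "one.x Issue2 = 0" using one.x_Issue2(2) x1 by simp
    show ?thesis
      using imp pay
      by (simp add: pareto_improves_iff one.payoff_GI1 one.payoff_GI2 one.payoff_DP x1 x2 weight_def Let_def)
  next
    case True
    then have "two.x i = 1" for i using x by (cases i) simp_all
    then show ?thesis by (rule improves_cheap_if_active[OF imp])
  qed
qed

end

end

theorem theorem2:
  fixes \<pi> f :: "issue \<Rightarrow> real" and \<alpha> :: real
  assumes "\<And>i. 0 < \<pi> i \<and> \<pi> i < 1/2"
    and "\<And>i. 0 < f i \<and> f i < 1"
    and "\<alpha> > 1"
  shows
    "(\<exists>\<sigma>. equilibrium \<pi> f \<alpha> 1 \<sigma>) \<and> (\<exists>\<tau>. equilibrium \<pi> f \<alpha> 2 \<tau>) \<and>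
     ((\<forall>\<sigma> \<tau>. equilibrium \<pi> f \<alpha> 1 \<sigma> \<and> equilibrium \<pi> f \<alpha> 2 \<tau> \<longrightarrow> pareto_improves \<pi> f \<alpha> \<sigma> \<tau>)
        \<longleftrightarrow> (\<alpha> * \<pi> Issue1 * f Issue1 + (2 * \<alpha> - 1) * \<pi> Issue2 * f Issue2)
          / (\<pi> Issue1 * \<pi> Issue2) \<le> 1) \<and>
     (f Issue2 \<noteq> 1 - \<pi> Issue1 \<longrightarrow>
        (\<forall>\<sigma> \<tau>. equilibrium \<pi> f \<alpha> 1 \<sigma> \<and> equilibrium \<pi> f \<alpha> 2 \<tau> \<longrightarrow>
           (pareto_improves \<pi> f \<alpha> \<sigma> \<tau>
            \<longleftrightarrow> (\<alpha> * \<pi> Issue1 * f Issue1 + (2 * \<alpha> - 1) * \<pi> Issue2 * f Issue2)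
          / (\<pi> Issue1 * \<pi> Issue2) \<le> 1)))"
proof -
  interpret lobbying \<pi> f \<alpha> by unfold_locales (use assms in auto)
  have cheap: "(\<alpha> * \<pi> Issue1 * f Issue1 + (2 * \<alpha> - 1) * \<pi> Issue2 * f Issue2)
      / (\<pi> Issue1 * \<pi> Issue2) \<le> 1 \<longleftrightarrow> cheap_lobbying"
    unfolding cheap_lobbying_def using prior(1) by (intro divide_le_eq_1_pos mult_pos_pos)
  \<comment> \<open>Comparing all pairs with this \<open>\<tau>\<close>, where both high types
    lobby, gives necessity even on the knife edge, through
    \<open>improves_cheap_if_active\<close>.\<close>
  obtain \<tau> where \<tau>: "equilibrium \<pi> f \<alpha> 2 \<tau>" "\<And>i. lobby \<tau> i True = 1"
    using two_reforms_equilibrium_exists by blast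
  show ?thesis
    unfolding cheap
    using one_reform_equilibrium_exists \<tau> cheap_improves improves_cheap improves_cheap_if_active
    by blast
qed

end
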